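(* Let $K$ be a local field with residue characteristic $p$, with ring of integers $O$ and maximal ideal $m$, and let $f_K$ be defined by $|O/m|=p^{f_K}$. Let $\rho_K=\rho_{e,p}$ with $e=v_K(p)$. Then $U_{\bullet}(K)\simeq M_{\rho_K}^{f_K}$ as filtered $\mathbb{Z}_p$-modules if and only if $\mu_p(K)=\{1\}$.
   Context: A local field $K$ is a field with a non-archimedean absolute value for which it is a non-discrete locally compact space; $v_K$ is its normalized valuation, $O$ its ring of integers, $m$ its maximal ideal, $p$ its residue characteristic ($v_K(p)=\infty$ if $\mathrm{char}(K)=p$). $\mu_p(K)=\{\alpha\in K:\alpha^p=1\}$. $U_i(K)=1+m^i$ for $i\ge 1$; $U_1(K)$ is a (multiplicatively written) $\mathbb{Z}_p$-module. A filtered $\mathbb{Z}_p$-module $M_\bullet$ is a sequence of $\mathbb{Z}_p$-modules $M_1\supseteq M_2\supseteq\cdots$ with $\bigcap_i M_i=\{0\}$; its weight map is $w(x)=\sup\{i: x\in M_i\}\in\mathbb{Z}_{\ge1}\cup\{\infty\}$, and the weight map determines the filtration via $M_i=\{x: w(x)\ge i\}$. A morphism $M_\bullet\to N_\bullet$ is a $\mathbb{Z}_p$-linear map $\phi:M_1\to N_1$ with $\phi(M_i)\subseteq N_i$ for all $i$; isomorphisms are morphisms having an inverse morphism. $U_\bullet(K)$ denotes $U_1(K)$ with the filtration $U_1(K)\supseteq U_2(K)\supseteq\cdots$. Products and direct sums of filtered modules carry the termwise filtration ($i$-th step is the product, resp. sum, of the $i$-th steps). A shift is a strictly increasing function $\rho:\mathbb{Z}_{\ge1}\to\mathbb{Z}_{\ge1}$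 with $\rho(1)>1$; $T_\rho=\mathbb{Z}_{\ge1}\setminus\rho(\mathbb{Z}_{\ge1})$. For $e\in\mathbb{Z}_{>0}\cup\{\infty\}$, $\rho_{e,p}(i)=\min\{i+e,pi\}$. For a shift $\rho$ and $i\in\mathbb{Z}_{\ge1}$, $S_i$ is the filtered $\mathbb{Z}_p$-module $\mathbb{Z}_p$ with weight map $w(x)=\rho^{\mathrm{ord}_p(x)}(i)$ (iterate of $\rho$; $w(0)=\infty$). $M_\rho=\prod_{i\in T_\rho}S_i$, and $M_\rho^f$ is the direct sum of $f$ copies of $M_\rho$. *)

theory Defs
  imports
    "HOL-Analysis.Analysis"
    "HOL-Algebra.Ideal_Product"
    "HOL-Algebra.QuotRing"
    "HOL-Algebra.Divisibility"
    "HOL-Algebra.Module"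
    "HOL-Algebra.Multiplicative_Group"
begin

section \<open>The ring of p-adic integers\<close>

text \<open>Inverse limit of the rings of integers modulo \<open>p ^ n\<close>: \<open>x n\<close> is the least nonnegative
  representative of the image of \<open>x\<close> modulo \<open>p ^ n\<close>.\<close>

definition Zp :: "nat \<Rightarrow> (nat \<Rightarrow> int) ring" where
  "Zp p =
    \<lparr>carrier = {x. \<forall>n. x n \<in> {0..<int p ^ n} \<and> x (Suc n) mod int p ^ n = x n},
     mult = (\<lambda>x y n. (x n * y n) mod int p ^ n),
     one = (\<lambda>n. 1 mod int p ^ n),
     zero = (\<lambda>n. 0),
     add = (\<lambda>x y n. (x n + y n) mod int p ^ n)\<rparr>"

text \<open>Only meaningful for nonzero \<open>x\<close>.\<close>

definition ord_p :: "nat \<Rightarrow> (nat \<Rightarrow> int) \<Rightarrow> nat" where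
  "ord_p p x =
    (GREATEST n. (([p] \<cdot>\<^bsub>Zp p\<^esub> \<one>\<^bsub>Zp p\<^esub>) [^]\<^bsub>Zp p\<^esub> n) divides\<^bsub>Zp p\<^esub> x)"


section \<open>Filtered modules\<close>

text \<open>Filtrations are indexed from 1; the value of \<open>filt\<close> at 0 is never used.  The fields \<open>mult\<close>
  and \<open>one\<close> that a \<open>module\<close> record inherits from rings play no role for modules.\<close>

record ('r, 'm) filtered_module = "('r, 'm) module" +
  filt :: "nat \<Rightarrow> 'm set"

locale filtered_module = Module.module R M
  for R :: "('r, 'x) ring_scheme" and M :: "('r, 'm, 'y) filtered_module_scheme" +
  assumes filt_1: "filt M 1 = carrier M"
    and filt_submodule: "1 \<le> i \<Longrightarrow> submodule (filt M i) R M"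
    and filt_decreasing: "1 \<le> i \<Longrightarrow> filt M (Suc i) \<subseteq> filt M i"
    and filt_separated: "(\<Inter>i\<in>{1..}. filt M i) = {\<zero>\<^bsub>M\<^esub>}"

definition filtered_hom ::
  "('r, 'x) ring_scheme \<Rightarrow> ('r, 'm, 'y) filtered_module_scheme \<Rightarrow>
    ('r, 'n, 'z) filtered_module_scheme \<Rightarrow> ('m \<Rightarrow> 'n) set" where
  "filtered_hom R M N = {\<phi>. \<phi> \<in> carrier M \<rightarrow> carrier N \<and>
     (\<forall>x\<in>carrier M. \<forall>y\<in>carrier M. \<phi> (x \<oplus>\<^bsub>M\<^esub> y) = \<phi> x \<oplus>\<^bsub>N\<^esub> \<phi> y) \<and>
     (\<forall>a\<in>carrier R. \<forall>x\<in>carrier M. \<phi> (a \<odot>\<^bsub>M\<^esub> x) = a \<odot>\<^bsub>N\<^esub> \<phi> x) \<and>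
     (\<forall>i\<ge>1. \<phi> ` filt M i \<subseteq> filt N i)}"

definition filtered_isomorphic ::
  "('r, 'x) ring_scheme \<Rightarrow> ('r, 'm, 'y) filtered_module_scheme \<Rightarrow>
    ('r, 'n, 'z) filtered_module_scheme \<Rightarrow> bool" where
  "filtered_isomorphic R M N \<longleftrightarrow> filtered_module R M \<and> filtered_module R N \<and>
     (\<exists>\<phi>\<in>filtered_hom R M N. \<exists>\<psi>\<in>filtered_hom R N M.
        (\<forall>x\<in>carrier M. \<psi> (\<phi> x) = x) \<and> (\<forall>y\<in>carrier N. \<phi> (\<psi> y) = y))"

definition filtered_prod ::
  "'i set \<Rightarrow> ('i \<Rightarrow> ('r, 'm) filtered_module) \<Rightarrow> ('r, 'i \<Rightarrow> 'm) filtered_module" where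
  "filtered_prod I M =
    \<lparr>carrier = (\<Pi>\<^sub>E i\<in>I. carrier (M i)),
     mult = undefined, one = undefined,
     zero = (\<lambda>i\<in>I. \<zero>\<^bsub>M i\<^esub>),
     add = (\<lambda>x y. \<lambda>i\<in>I. x i \<oplus>\<^bsub>M i\<^esub> y i),
     smult = (\<lambda>a x. \<lambda>i\<in>I. a \<odot>\<^bsub>M i\<^esub> x i),
     filt = (\<lambda>j. \<Pi>\<^sub>E i\<in>I. filt (M i) j)\<rparr>"

definition filtered_direct_sum ::
  "'i set \<Rightarrow> ('i \<Rightarrow> ('r, 'm) filtered_module) \<Rightarrow> ('r, 'i \<Rightarrow> 'm) filtered_module" where
  "filtered_direct_sum I M =
    \<lparr>carrier = {x \<in> \<Pi>\<^sub>E i\<in>I. carrier (M i). finite {i \<in> I. x i \<noteq> \<zero>\<^bsub>M i\<^esub>}},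
     mult = undefined, one = undefined,
     zero = (\<lambda>i\<in>I. \<zero>\<^bsub>M i\<^esub>),
     add = (\<lambda>x y. \<lambda>i\<in>I. x i \<oplus>\<^bsub>M i\<^esub> y i),
     smult = (\<lambda>a x. \<lambda>i\<in>I. a \<odot>\<^bsub>M i\<^esub> x i),
     filt = (\<lambda>j. {x \<in> \<Pi>\<^sub>E i\<in>I. filt (M i) j. finite {i \<in> I. x i \<noteq> \<zero>\<^bsub>M i\<^esub>}})\<rparr>"


section \<open>The standard filtered modules of a shift\<close>

definition shift_compl :: "(nat \<Rightarrow> nat) \<Rightarrow> nat set" where
  "shift_compl \<rho> = {1..} - \<rho> ` {1..}"

definition std_weight :: "nat \<Rightarrow> (nat \<Rightarrow> nat) \<Rightarrow> nat \<Rightarrow> (nat \<Rightarrow> int) \<Rightarrow> enat" where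
  "std_weight p \<rho> i x = (if x = \<zero>\<^bsub>Zp p\<^esub> then \<infinity> else enat ((\<rho> ^^ ord_p p x) i))"

definition std_filtered ::
  "nat \<Rightarrow> (nat \<Rightarrow> nat) \<Rightarrow> nat \<Rightarrow> (nat \<Rightarrow> int, nat \<Rightarrow> int) filtered_module" where
  "std_filtered p \<rho> i =
    \<lparr>carrier = carrier (Zp p),
     mult = mult (Zp p), one = \<one>\<^bsub>Zp p\<^esub>,
     zero = \<zero>\<^bsub>Zp p\<^esub>,
     add = add (Zp p),
     smult = mult (Zp p),
     filt = (\<lambda>j. {x \<in> carrier (Zp p). enat j \<le> std_weight p \<rho> i x})\<rparr>"

definition M_shift ::
  "nat \<Rightarrow> (nat \<Rightarrow> nat) \<Rightarrow> (nat \<Rightarrow> int, nat \<Rightarrow> nat \<Rightarrow> int) filtered_module" where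
  "M_shift p \<rho> = filtered_prod (shift_compl \<rho>) (std_filtered p \<rho>)"

definition M_shift_pow ::
  "nat \<Rightarrow> (nat \<Rightarrow> nat) \<Rightarrow> nat \<Rightarrow> (nat \<Rightarrow> int, nat \<Rightarrow> nat \<Rightarrow> nat \<Rightarrow> int) filtered_module" where
  "M_shift_pow p \<rho> f = filtered_direct_sum {..<f} (\<lambda>_. M_shift p \<rho>)"

definition rho :: "enat \<Rightarrow> nat \<Rightarrow> nat \<Rightarrow> nat" where
  "rho e p i = the_enat (min (enat i + e) (enat (p * i)))"


section \<open>Local fields\<close>

text \<open>A valued field is a field type together with a real-valued absolute value \<open>nm\<close>.\<close>

definition nonarch_abs :: "('a::field \<Rightarrow> real) \<Rightarrow> bool" where
  "nonarch_abs nm \<longleftrightarrow>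
     (\<forall>x. 0 \<le> nm x) \<and> (\<forall>x. nm x = 0 \<longleftrightarrow> x = 0) \<and>
     (\<forall>x y. nm (x * y) = nm x * nm y) \<and> (\<forall>x y. nm (x + y) \<le> max (nm x) (nm y))"

definition abs_topology :: "('a::field \<Rightarrow> real) \<Rightarrow> 'a topology" where
  "abs_topology nm = Metric_space.mtopology UNIV (\<lambda>x y. nm (x - y))"

definition local_field :: "('a::field \<Rightarrow> real) \<Rightarrow> bool" where
  "local_field nm \<longleftrightarrow> nonarch_abs nm \<and>
     locally_compact_space (abs_topology nm) \<and> abs_topology nm \<noteq> discrete_topology UNIV"

definition int_ring :: "('a::field \<Rightarrow> real) \<Rightarrow> 'a ring" where
  "int_ring nm = \<lparr>carrier = {x. nm x \<le> 1}, mult = (*), one = 1, zero = 0, add = (+)\<rparr>"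

definition max_ideal :: "('a::field \<Rightarrow> real) \<Rightarrow> 'a set" where
  "max_ideal nm = {x. nm x < 1}"

definition residue_field :: "('a::field \<Rightarrow> real) \<Rightarrow> 'a set ring" where
  "residue_field nm = int_ring nm Quot max_ideal nm"

text \<open>The characteristic of the residue field, as the additive order of its unit element.\<close>

definition residue_char :: "('a::field \<Rightarrow> real) \<Rightarrow> nat" where
  "residue_char nm = group.ord (add_monoid (residue_field nm)) \<one>\<^bsub>residue_field nm\<^esub>"

text \<open>Compatibility with \<open>nm\<close> makes the ultrametric inequality for \<open>v\<close> a consequence of the one
  for \<open>nm\<close>; together with the value group being the integers it determines \<open>v\<close>.\<close>

definition normalized_valuation :: "('a::field \<Rightarrow> real) \<Rightarrow> ('a \<Rightarrow> ereal) \<Rightarrow> bool" where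
  "normalized_valuation nm v \<longleftrightarrow>
     v 0 = \<infinity> \<and> v ` (UNIV - {0}) = range (\<lambda>k::int. ereal (of_int k)) \<and>
     (\<forall>x y. v (x * y) = v x + v y) \<and> (\<forall>x y. nm x \<le> nm y \<longleftrightarrow> v y \<le> v x)"

primrec ideal_pow :: "('a, 'b) ring_scheme \<Rightarrow> 'a set \<Rightarrow> nat \<Rightarrow> 'a set" where
  "ideal_pow R I 0 = carrier R"
| "ideal_pow R I (Suc n) = ideal_prod R I (ideal_pow R I n)"

definition unit_filt :: "('a::field \<Rightarrow> real) \<Rightarrow> nat \<Rightarrow> 'a set" where
  "unit_filt nm i = {1 + x |x. x \<in> ideal_pow (int_ring nm) (max_ideal nm) i}"

text \<open>The exponentiation of principal units by p-adic integers, as a limit of integer powers.\<close>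

definition padic_pow :: "('a::field \<Rightarrow> real) \<Rightarrow> (nat \<Rightarrow> int) \<Rightarrow> 'a \<Rightarrow> 'a" where
  "padic_pow nm a u = (THE y. limitin (abs_topology nm) (\<lambda>n. u powi a n) y sequentially)"

text \<open>The module is written multiplicatively: its addition is the multiplication of the field.\<close>

definition U_filtered :: "('a::field \<Rightarrow> real) \<Rightarrow> (nat \<Rightarrow> int, 'a) filtered_module" where
  "U_filtered nm =
    \<lparr>carrier = unit_filt nm 1,
     mult = undefined, one = undefined,
     zero = 1,
     add = (*),
     smult = padic_pow nm,
     filt = unit_filt nm\<rparr>"

definition mu :: "nat \<Rightarrow> 'a::field set" where
  "mu p = {\<alpha>. \<alpha> ^ p = 1}"

end

theory Submission
  imports Defs
begin

text \<open>
  Let \<open>P n\<close> be the \<open>n\<close>-th power of the maximal ideal and \<open>U n = 1 + P n\<close>.  The map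
  \<open>1 + \<pi> ^ n * b \<mapsto> b\<close> identifies \<open>U n / U (n + 1)\<close> with the residue field, a vector space of
  dimension \<open>f\<close> over \<open>\<int>/p\<close>.  Since \<open>(1 + y) ^ p\<close> is \<open>1 + y ^ p + p * y\<close> up to smaller terms, raising
  to the power \<open>p\<close> carries \<open>U n\<close> into \<open>U (\<rho> n)\<close>.

  If there are no \<open>p\<close>-th roots of unity besides 1, the induced map from \<open>U n / U (n + 1)\<close> to
  \<open>U (\<rho> n) / U (\<rho> n + 1)\<close> is injective for every \<open>n\<close> (\<open>p_power_reflects_level\<close>).  Indeed \<open>y ^ p\<close> and
  \<open>p * y\<close> have different absolute values unless \<open>(p - 1) * n = e\<close>; at that index, every element
  of \<open>U (\<rho> n + 1)\<close> has a \<open>p\<close>-th root in \<open>U (n + 1)\<close> (\<open>p_th_root\<close>), so a nontrivial kernel would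
  produce a \<open>p\<close>-th root of unity.  Source and target have \<open>p ^ f\<close> elements each, so bases go to
  bases.  Choose a basis of \<open>U i / U (i + 1)\<close> for each \<open>i\<close> outside the image of \<open>\<rho>\<close>.  Every level is
  \<open>(\<rho> ^^ k) i\<close> for exactly one such \<open>i\<close> and one \<open>k\<close> (\<open>shift_orbits\<close>), so iterated \<open>p\<close>-th powers give a
  basis \<open>w n\<close> at every level \<open>n\<close> (\<open>compatible_bases_exist\<close>).

  Consequently each principal unit is a convergent product of powers of the \<open>w n j\<close> with unique
  exponents in \<open>{0..<p}\<close>.  Along an orbit of \<open>\<rho>\<close> these exponents are the digits of one \<open>p\<close>-adic
  integer, which rewrites the product as one of \<open>p\<close>-adic powers of the \<open>w i j\<close> with \<open>i\<close> outside the
  image of \<open>\<rho>\<close>.  This gives the isomorphism; it matches the filtrations because in both modules the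
  step \<open>n\<close> consists of the elements whose digits below level \<open>n\<close> vanish (\<open>unit_of_filt_iff\<close>).

  Conversely, the elements of \<open>mu p\<close> are principal units annihilated by \<open>p\<close>, whereas the standard
  module has no \<open>p\<close>-torsion.

  Limits and infinite products are handled through congruences modulo all \<open>P N\<close> between finite
  approximations; the topology enters only to obtain completeness, the finiteness of the residue
  field, and the value of the limit that defines a \<open>p\<close>-adic power.
\<close>

section \<open>The ring of p-adic integers\<close>

lemma Zp_simps:
  "mult (Zp p) x y = (\<lambda>n. (x n * y n) mod int p ^ n)"
  "add (Zp p) x y = (\<lambda>n. (x n + y n) mod int p ^ n)"
  "one (Zp p) = (\<lambda>n. 1 mod int p ^ n)"
  "zero (Zp p) = (\<lambda>n. 0)"
  by (simp_all add: Zp_def)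

lemmas [simp] = Zp_simps(1,2,4)

lemma Zp_carrier_iff:
  "x \<in> carrier (Zp p) \<longleftrightarrow> (\<forall>n. x n \<in> {0..<int p ^ n} \<and> x (Suc n) mod int p ^ n = x n)"
  by (simp add: Zp_def)

lemma mod_power_Suc_mod: "a mod q ^ Suc n mod q ^ n = a mod (q ^ n :: int)"
  by (simp add: mod_mod_cancel)

lemma Zp_carrierI:
  assumes "p > 0" and "\<And>n. x (Suc n) mod int p ^ n = x n mod int p ^ n"
  shows "(\<lambda>n. x n mod int p ^ n) \<in> carrier (Zp p)"
  unfolding Zp_carrier_iff using assms by (auto simp: mod_power_Suc_mod simp del: power_Suc)

lemma Zp_reduced: "x \<in> carrier (Zp p) \<Longrightarrow> x n mod int p ^ n = x n"
  unfolding Zp_carrier_iff by auto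

lemma Zp_nonneg: "x \<in> carrier (Zp p) \<Longrightarrow> 0 \<le> x n"
  unfolding Zp_carrier_iff by auto

lemma Zp_at_0: "x \<in> carrier (Zp p) \<Longrightarrow> x 0 = 0"
  unfolding Zp_carrier_iff by (metis atLeastLessThan_iff int_one_le_iff_zero_less leD linorder_neqE power_0)

lemma Zp_compatible:
  assumes "x \<in> carrier (Zp p)" "n \<le> m"
  shows "x m mod int p ^ n = x n"
  using assms(2)
proof (induction m rule: dec_induct)
  case base
  then show ?case using assms(1) by (rule Zp_reduced)
next
  case (step m)
  have "x (Suc m) mod int p ^ n = x (Suc m) mod int p ^ m mod int p ^ n"
    using step by (simp add: mod_mod_cancel le_imp_power_dvd)
  also have "x (Suc m) mod int p ^ m = x m"
    using assms(1) by (simp add: Zp_carrier_iff)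
  finally show ?case using step by simp
qed

lemma Zp_zero_mono: "\<lbrakk>x \<in> carrier (Zp p); n \<le> m; x m = 0\<rbrakk> \<Longrightarrow> x n = 0"
  using Zp_compatible[of x p n m] by simp

lemma Zp_zero_iff: "x \<in> carrier (Zp p) \<Longrightarrow> x = \<zero>\<^bsub>Zp p\<^esub> \<longleftrightarrow> (\<forall>k. x (Suc k) = 0)"
  by (auto simp: fun_eq_iff) (metis Zp_at_0 not0_implies_Suc)

lemma Zp_step: "x \<in> carrier (Zp p) \<Longrightarrow> x (Suc n) mod int p ^ n = x n mod int p ^ n"
  by (metis Zp_carrier_iff Zp_reduced)

lemma Zp_closed:
  assumes "p > 0" "x \<in> carrier (Zp p)" "y \<in> carrier (Zp p)"
  shows "(\<lambda>n. (x n + y n) mod int p ^ n) \<in> carrier (Zp p)"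
    and "(\<lambda>n. (x n * y n) mod int p ^ n) \<in> carrier (Zp p)"
    and "(\<lambda>n. (- x n) mod int p ^ n) \<in> carrier (Zp p)"
  using assms(2,3)[THEN Zp_step]
  by (auto intro!: Zp_carrierI[OF assms(1)] intro: mod_add_cong mod_mult_cong mod_minus_cong)

lemma int_div_less:
  assumes "0 < c" "a < b * (c::int)"
  shows "a div c < b"
proof (rule ccontr)
  assume "\<not> a div c < b"
  then have "b * c \<le> a div c * c"
    using assms(1) by (intro mult_right_mono) auto
  then show False
    using assms div_mult_mod_eq[of a c] pos_mod_sign[of c a] by linarith
qed

lemma Zp_cring:
  assumes "p > 0"
  shows "cring (Zp p)"
proof (rule cringI)
  note closed = Zp_closed[OF assms]
  show "abelian_group (Zp p)"
  proof (rule abelian_groupI, simp_all only: Zp_simps)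
    fix x y z assume x: "x \<in> carrier (Zp p)" and y: "y \<in> carrier (Zp p)" and z: "z \<in> carrier (Zp p)"
    show "(\<lambda>n. (x n + y n) mod int p ^ n) \<in> carrier (Zp p)" 
      by (rule closed x y)+
    show "(\<lambda>n. ((x n + y n) mod int p ^ n + z n) mod int p ^ n) 
        = (\<lambda>n. (x n + (y n + z n) mod int p ^ n) mod int p ^ n)"
      by (simp add: mod_add_left_eq mod_add_right_eq add.assoc)
    show "(\<lambda>n. (x n + y n) mod int p ^ n) = (\<lambda>n. (y n + x n) mod int p ^ n)"
      by (simp add: add.commute)
    show "(\<lambda>n. (0 + x n) mod int p ^ n) = x"
      using x by (simp add: Zp_reduced)
    show "\<exists>y\<in>carrier (Zp p). (\<lambda>n. (y n + x n) mod int p ^ n) = (\<lambda>n. 0)"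
      by (rule bexI[OF _ closed(3)[OF x x]]) (simp add: mod_add_left_eq)
  next
    show "(\<lambda>n. 0) \<in> carrier (Zp p)"
      by (simp add: Zp_carrier_iff assms)
  qed
  show "comm_monoid (Zp p)"
  proof (rule comm_monoidI, simp_all only: Zp_simps)
    fix x y z assume x: "x \<in> carrier (Zp p)" and y: "y \<in> carrier (Zp p)" and z: "z \<in> carrier (Zp p)"
    show "(\<lambda>n. (x n * y n) mod int p ^ n) \<in> carrier (Zp p)" 
      by (rule closed x y)+
    show "(\<lambda>n. ((x n * y n) mod int p ^ n * z n) mod int p ^ n) 
        = (\<lambda>n. (x n * ((y n * z n) mod int p ^ n)) mod int p ^ n)"
      by (simp add: mod_mult_left_eq mod_mult_right_eq mult.assoc)
    show "(\<lambda>n. (x n * y n) mod int p ^ n) = (\<lambda>n. (y n * x n) mod int p ^ n)"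
      by (simp add: mult.commute)
    show "(\<lambda>n. (1 mod int p ^ n * x n) mod int p ^ n) = x"
      using x by (simp add: Zp_reduced mod_mult_left_eq)
  next
    show "(\<lambda>n. 1 mod int p ^ n) \<in> carrier (Zp p)"
      by (rule Zp_carrierI[OF assms]) simp
  qed
qed (simp add: mod_mult_left_eq mod_add_eq distrib_right)

lemma Zp_of_nat:
  assumes "p > 0"
  shows "[k] \<cdot>\<^bsub>Zp p\<^esub> \<one>\<^bsub>Zp p\<^esub> = (\<lambda>n. int k mod int p ^ n)"
proof -
  interpret cring "Zp p" by (rule Zp_cring) fact
  show ?thesis
    by (induction k) (simp_all add: Zp_simps mod_add_eq add.commute)
qed

lemma Zp_p_power:
  assumes "p > 0"
  shows "([p] \<cdot>\<^bsub>Zp p\<^esub> \<one>\<^bsub>Zp p\<^esub>) [^]\<^bsub>Zp p\<^esub> k = (\<lambda>n. int p ^ k mod int p ^ n)"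
proof -
  interpret cring "Zp p" by (rule Zp_cring) fact
  show ?thesis
    by (induction k)
       (simp_all add: Zp_simps(3) Zp_of_nat[OF assms, unfolded Zp_simps] mod_mult_eq mult.commute)
qed

text \<open>The quotient by \<open>p ^ k\<close> is read off from the residues modulo higher powers of \<open>p\<close>.\<close>

lemma Zp_p_power_divides_iff:
  assumes "p > 0" "x \<in> carrier (Zp p)"
  shows "([p] \<cdot>\<^bsub>Zp p\<^esub> \<one>\<^bsub>Zp p\<^esub>) [^]\<^bsub>Zp p\<^esub> k divides\<^bsub>Zp p\<^esub> x \<longleftrightarrow> x k = 0"
proof
  assume "([p] \<cdot>\<^bsub>Zp p\<^esub> \<one>\<^bsub>Zp p\<^esub>) [^]\<^bsub>Zp p\<^esub> k divides\<^bsub>Zp p\<^esub> x"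
  then show "x k = 0"
    by (auto simp: factor_def Zp_p_power[OF assms(1)])
next
  assume 0: "x k = 0"
  define c where "c n = x (n + k) div int p ^ k" for n
  have dvd: "int p ^ k dvd x (n + k)" for n
    using Zp_compatible[OF assms(2), of k "n + k"] 0 by auto
  have "c (Suc n) mod int p ^ n = c n" for n
  proof -
    have "c (Suc n) mod int p ^ n * int p ^ k = (c (Suc n) * int p ^ k) mod (int p ^ n * int p ^ k)"
      by (simp add: mod_mult_mult2)
    also have "c (Suc n) * int p ^ k = x (Suc n + k)"
      unfolding c_def using dvd[of "Suc n"] by (rule dvd_div_mult_self)
    also have "x (Suc n + k) mod (int p ^ n * int p ^ k) = x (n + k)"
      using Zp_compatible[OF assms(2), of "n + k" "Suc n + k"] by (simp add: power_add)
    also have "\<dots> = c n * int p ^ k"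
      unfolding c_def using dvd by simp
    finally show ?thesis using assms(1) by simp
  qed
  moreover have "c n \<in> {0..<int p ^ n}" for n
  proof -
    have "0 \<le> x (n + k)" "x (n + k) < int p ^ n * int p ^ k"
      using assms(2) unfolding Zp_carrier_iff by (auto simp flip: power_add)
    then show ?thesis
      unfolding c_def using assms(1)
      by (simp add: pos_imp_zdiv_nonneg_iff int_div_less)
  qed
  ultimately have "c \<in> carrier (Zp p)"
    by (simp add: Zp_carrier_iff)
  moreover have "x n = int p ^ k mod int p ^ n * c n mod int p ^ n" for n
  proof -
    have "int p ^ k mod int p ^ n * c n mod int p ^ n = x (n + k) mod int p ^ n"
      unfolding c_def using dvd by (simp add: mod_mult_left_eq)
    then show ?thesis using Zp_compatible[OF assms(2), of n "n + k"] by simp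
  qed
  ultimately show "([p] \<cdot>\<^bsub>Zp p\<^esub> \<one>\<^bsub>Zp p\<^esub>) [^]\<^bsub>Zp p\<^esub> k divides\<^bsub>Zp p\<^esub> x"
    by (auto simp: factor_def Zp_p_power[OF assms(1)])
qed

text \<open>The powers of \<open>p\<close> dividing a nonzero \<open>x\<close> are bounded, so the greatest exponent exists; vanishing of
  residues turns the valuation into a condition on single entries of the sequence.\<close>

lemma le_ord_p_iff:
  assumes "p > 0" "x \<in> carrier (Zp p)" "x \<noteq> \<zero>\<^bsub>Zp p\<^esub>"
  shows "k \<le> ord_p p x \<longleftrightarrow> x k = 0"
proof -
  obtain b where b: "x b \<noteq> 0"
    using assms(3) by auto
  have bound: "k \<le> b" if "x k = 0" for k
    using Zp_zero_mono[OF assms(2) _ that, of b] b by force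
  have eq: "ord_p p x = (GREATEST n. x n = 0)"
    unfolding ord_p_def using Zp_p_power_divides_iff[OF assms(1,2)] by simp
  have "x (ord_p p x) = 0"
    unfolding eq using GreatestI_nat[of "\<lambda>n. x n = 0" 0 b] bound Zp_at_0[OF assms(2)] by blast
  moreover have "k \<le> ord_p p x" if "x k = 0" for k
    unfolding eq using Greatest_le_nat[of "\<lambda>n. x n = 0" k b] bound that by blast
  ultimately show ?thesis
    using Zp_zero_mono[OF assms(2), of k "ord_p p x"] by blast
qed

lemma Zp_p_torsion_free:
  assumes "p > 0" "x \<in> carrier (Zp p)"
    and "([p] \<cdot>\<^bsub>Zp p\<^esub> \<one>\<^bsub>Zp p\<^esub>) \<otimes>\<^bsub>Zp p\<^esub> x = \<zero>\<^bsub>Zp p\<^esub>"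
  shows "x = \<zero>\<^bsub>Zp p\<^esub>"
proof -
  have "x n = 0" for n
  proof -
    have "(int p * x (Suc n)) mod (int p * int p ^ n) = 0"
      using fun_cong[OF assms(3), of "Suc n"] by (simp add: Zp_of_nat[OF assms(1)] mod_mult_left_eq)
    then have "int p ^ n dvd x (Suc n)"
      using assms(1) by auto
    then show ?thesis
      using Zp_compatible[OF assms(2), of n "Suc n"] by simp
  qed
  then show ?thesis by auto
qed

subsection \<open>Digits\<close>

definition Zp_digit :: "nat \<Rightarrow> (nat \<Rightarrow> int) \<Rightarrow> nat \<Rightarrow> nat" where
  "Zp_digit p x k = nat (x (Suc k) div int p ^ k)"

definition Zp_of_digits :: "nat \<Rightarrow> (nat \<Rightarrow> nat) \<Rightarrow> nat \<Rightarrow> int" where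
  "Zp_of_digits p d n = int (\<Sum>k<n. d k * p ^ k)"

text \<open>Digits below \<open>p\<close> leave no carry: this bound makes the digits of a sum recoverable by division.\<close>

lemma digit_sum_less:
  assumes "\<And>k. d k < (p::nat)"
  shows "(\<Sum>k<n. d k * p ^ k) < p ^ n"
proof (induction n)
  case (Suc n)
  have "(\<Sum>k<Suc n. d k * p ^ k) < p ^ n + d n * p ^ n"
    using Suc by simp
  also have "\<dots> = Suc (d n) * p ^ n" by simp
  also have "\<dots> \<le> p ^ Suc n"
    using assms[of n] by (simp only: power_Suc) (intro mult_right_mono, auto)
  finally show ?case .
qed simp

lemma Zp_of_digits_closed:
  assumes "\<And>k. d k < p"
  shows "Zp_of_digits p d \<in> carrier (Zp p)"
  unfolding Zp_carrier_iff Zp_of_digits_def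
proof (intro allI conjI)
  fix n
  have less: "int (\<Sum>k<n. d k * p ^ k) < int p ^ n"
    using digit_sum_less[OF assms, where n = n] unfolding of_nat_power[symmetric] of_nat_less_iff .
  then show "int (\<Sum>k<n. d k * p ^ k) \<in> {0..<int p ^ n}"
    by (simp only: atLeastLessThan_iff of_nat_0_le_iff)
  show "int (\<Sum>k<Suc n. d k * p ^ k) mod int p ^ n = int (\<Sum>k<n. d k * p ^ k)"
    using less unfolding sum.lessThan_Suc of_nat_add
    by (simp only: of_nat_mult of_nat_power mod_mult_self3 mod_mult_self1 mod_pos_pos_trivial of_nat_0_le_iff)
qed

lemma Zp_digit_of_digits:
  assumes "\<And>k. d k < p"
  shows "Zp_digit p (Zp_of_digits p d) k = d k"
proof -
  have "(\<Sum>k<Suc k. d k * p ^ k) div p ^ k = d k"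
    using digit_sum_less[OF assms, where n = k] assms[of k] by simp
  then show ?thesis
    unfolding Zp_digit_def Zp_of_digits_def by (metis nat_int of_nat_div of_nat_power)
qed

lemma Zp_Suc_eq:
  assumes "x \<in> carrier (Zp p)"
  shows "x (Suc k) = x k + int (Zp_digit p x k) * int p ^ k"
proof -
  have "x (Suc k) = x (Suc k) mod int p ^ k + x (Suc k) div int p ^ k * int p ^ k"
    by (rule mod_div_mult_eq[symmetric])
  moreover have "x (Suc k) mod int p ^ k = x k"
    using assms by (simp add: Zp_carrier_iff)
  moreover have "0 \<le> x (Suc k) div int p ^ k"
    using Zp_nonneg[OF assms] by (simp add: div_int_pos_iff)
  ultimately show ?thesis
    unfolding Zp_digit_def by simp
qed

lemma Zp_digit_expansion:
  assumes "x \<in> carrier (Zp p)"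
  shows "nat (x n) = (\<Sum>k<n. Zp_digit p x k * p ^ k)"
proof -
  have "x n = int (\<Sum>k<n. Zp_digit p x k * p ^ k)"
    by (induction n) (simp_all add: Zp_at_0[OF assms] Zp_Suc_eq[OF assms])
  then show ?thesis by (simp only: nat_int)
qed

lemma Zp_digit_less:
  assumes "p > 0" "x \<in> carrier (Zp p)"
  shows "Zp_digit p x k < p"
proof -
  have "x (Suc k) < int p * int p ^ k"
    using assms(2) unfolding Zp_carrier_iff by (metis atLeastLessThan_iff power_Suc)
  then have "x (Suc k) div int p ^ k < int p"
    using assms(1) by (simp add: int_div_less)
  then show ?thesis
    unfolding Zp_digit_def using Zp_nonneg[OF assms(2)] assms(1) by (simp add: nat_less_iff div_int_pos_iff)
qed

section \<open>Filtered modules\<close>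

text \<open>Closure under scalars includes closure under negation, so a filtration step needs no separate
  check of inverses.\<close>

lemma filtered_moduleI:
  fixes M :: "('r, 'm, 'y) filtered_module_scheme"
  assumes "Module.module R M"
    and "filt M 1 = carrier M"
    and decreasing: "\<And>i. 1 \<le> i \<Longrightarrow> filt M (Suc i) \<subseteq> filt M i"
    and zero: "\<And>i. 1 \<le> i \<Longrightarrow> \<zero>\<^bsub>M\<^esub> \<in> filt M i"
    and add: "\<And>i x y. \<lbrakk>1 \<le> i; x \<in> filt M i; y \<in> filt M i\<rbrakk> \<Longrightarrow> x \<oplus>\<^bsub>M\<^esub> y \<in> filt M i"
    and smult: "\<And>i a x. \<lbrakk>1 \<le> i; a \<in> carrier R; x \<in> filt M i\<rbrakk> \<Longrightarrow> a \<odot>\<^bsub>M\<^esub> x \<in> filt M i"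
    and separated: "\<And>x. \<lbrakk>x \<in> carrier M; \<And>i. 1 \<le> i \<Longrightarrow> x \<in> filt M i\<rbrakk> \<Longrightarrow> x = \<zero>\<^bsub>M\<^esub>"
  shows "filtered_module R M"
proof -
  interpret Module.module R M by fact
  have sub: "filt M i \<subseteq> carrier M" if "1 \<le> i" for i
    using that
  proof (induction i rule: dec_induct)
    case base
    then show ?case using assms(2) by simp
  next
    case (step n)
    then show ?case using decreasing[of n] by blast
  qed
  have neg: "\<ominus>\<^bsub>M\<^esub> x \<in> filt M i" if "1 \<le> i" "x \<in> filt M i" for i x
  proof -
    have x: "x \<in> carrier M" using sub that by blast
    have "\<ominus>\<^bsub>M\<^esub> x = (\<ominus>\<^bsub>R\<^esub> \<one>\<^bsub>R\<^esub>) \<odot>\<^bsub>M\<^esub> x"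
      using smult_l_minus[of "\<one>\<^bsub>R\<^esub>" x] x by simp
    then show ?thesis using smult[of i "\<ominus>\<^bsub>R\<^esub> \<one>\<^bsub>R\<^esub>" x] that by simp
  qed
  show ?thesis
  proof (intro filtered_module.intro filtered_module_axioms.intro)
    show "Module.module R M" by fact
    show "filt M 1 = carrier M" by fact
    show "submodule (filt M i) R M" if "1 \<le> i" for i
      using that by (auto intro!: submoduleI intro: sub[THEN subsetD] zero neg add smult)
    show "filt M (Suc i) \<subseteq> filt M i" if "1 \<le> i" for i
      using that by (rule decreasing)
    show "(\<Inter>i\<in>{1..}. filt M i) = {\<zero>\<^bsub>M\<^esub>}"
    proof (intro Set.set_eqI iffI)
      fix x assume "x \<in> (\<Inter>i\<in>{1..}. filt M i)"
      then have x: "x \<in> filt M i" if "1 \<le> i" for i using that by auto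
      show "x \<in> {\<zero>\<^bsub>M\<^esub>}"
        using separated[of x] x sub[of 1] by auto
    qed (auto intro: zero)
  qed
qed

lemma (in filtered_module) filt_closed: "\<lbrakk>1 \<le> i; x \<in> filt M i\<rbrakk> \<Longrightarrow> x \<in> carrier M"
  using submodule.axioms(1)[OF filt_submodule, THEN subgroup.subset] by auto

lemma (in filtered_module) filt_zero: "1 \<le> i \<Longrightarrow> \<zero>\<^bsub>M\<^esub> \<in> filt M i"
  using submodule.axioms(1)[OF filt_submodule, THEN subgroup.one_closed] by auto

lemma (in filtered_module) filt_add:
  "\<lbrakk>1 \<le> i; x \<in> filt M i; y \<in> filt M i\<rbrakk> \<Longrightarrow> x \<oplus>\<^bsub>M\<^esub> y \<in> filt M i"
  using submodule.axioms(1)[OF filt_submodule, THEN subgroup.m_closed] by auto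

lemma (in filtered_module) filt_smult:
  "\<lbrakk>1 \<le> i; a \<in> carrier R; x \<in> filt M i\<rbrakk> \<Longrightarrow> a \<odot>\<^bsub>M\<^esub> x \<in> filt M i"
  by (rule submodule.smult_closed[OF filt_submodule])

lemma (in filtered_module) filt_separatedD:
  "(\<And>i. 1 \<le> i \<Longrightarrow> x \<in> filt M i) \<Longrightarrow> x = \<zero>\<^bsub>M\<^esub>"
  using filt_separated by blast

lemma filtered_prod_simps [simp]:
  "carrier (filtered_prod I M) = (\<Pi>\<^sub>E i\<in>I. carrier (M i))"
  "zero (filtered_prod I M) = (\<lambda>i\<in>I. \<zero>\<^bsub>M i\<^esub>)"
  "add (filtered_prod I M) x y = (\<lambda>i\<in>I. x i \<oplus>\<^bsub>M i\<^esub> y i)"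
  "smult (filtered_prod I M) a x = (\<lambda>i\<in>I. a \<odot>\<^bsub>M i\<^esub> x i)"
  "filt (filtered_prod I M) j = (\<Pi>\<^sub>E i\<in>I. filt (M i) j)"
  by (simp_all add: filtered_prod_def)

lemma filtered_module_prod:
  assumes "cring R" and M: "\<And>i. i \<in> I \<Longrightarrow> filtered_module R (M i)"
  shows "filtered_module R (filtered_prod I M)"
proof (rule filtered_moduleI)
  have mod: "Module.module R (M i)" if "i \<in> I" for i
    using M[OF that] by (rule filtered_module.axioms(1))
  have ab: "abelian_group (M i)" if "i \<in> I" for i
    using mod[OF that] by (rule module.axioms(2))
  show "Module.module R (filtered_prod I M)"
  proof (rule moduleI)
    show "abelian_group (filtered_prod I M)"
    proof (rule abelian_groupI)
      fix x assume "x \<in> carrier (filtered_prod I M)"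
      then have x: "x i \<in> carrier (M i)" if "i \<in> I" for i using that by auto
      show "\<exists>y\<in>carrier (filtered_prod I M). y \<oplus>\<^bsub>filtered_prod I M\<^esub> x = \<zero>\<^bsub>filtered_prod I M\<^esub>"
        using x by (intro bexI[of _ "\<lambda>i\<in>I. \<ominus>\<^bsub>M i\<^esub> x i"])
          (auto intro!: restrict_ext abelian_group.l_neg abelian_group.a_inv_closed ab)
    qed (auto intro!: restrict_ext PiE_ext abelian_groupE[OF ab] simp: PiE_iff extensional_def fun_eq_iff
        intro: abelian_groupE[OF ab])
  next
    show "\<one>\<^bsub>R\<^esub> \<odot>\<^bsub>filtered_prod I M\<^esub> x = x" if "x \<in> carrier (filtered_prod I M)" for x
      using that module.smult_one[OF mod] by (auto simp: PiE_iff extensional_def fun_eq_iff)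
  qed (use assms(1) mod in \<open>auto intro!: restrict_ext module.smult_closed module.smult_l_distr
      module.smult_r_distr module.smult_assoc1 simp: PiE_iff\<close>)
  show "filt (filtered_prod I M) 1 = carrier (filtered_prod I M)"
    using filtered_module.filt_1[OF M] by (auto intro!: PiE_cong)
next
  fix i :: nat assume i: "1 \<le> i"
  show "filt (filtered_prod I M) (Suc i) \<subseteq> filt (filtered_prod I M) i"
    unfolding filtered_prod_simps by (intro PiE_mono filtered_module.filt_decreasing[OF M] i)
  show "\<zero>\<^bsub>filtered_prod I M\<^esub> \<in> filt (filtered_prod I M) i"
    using filtered_module.filt_zero[OF M i] by auto
  show "x \<oplus>\<^bsub>filtered_prod I M\<^esub> y \<in> filt (filtered_prod I M) i"
    if "x \<in> filt (filtered_prod I M) i" "y \<in> filt (filtered_prod I M) i" for x y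
    using that filtered_module.filt_add[OF M i] by (auto simp: PiE_iff)
  show "a \<odot>\<^bsub>filtered_prod I M\<^esub> x \<in> filt (filtered_prod I M) i"
    if "a \<in> carrier R" "x \<in> filt (filtered_prod I M) i" for a x
    using that filtered_module.filt_smult[OF M i] by (auto simp: PiE_iff)
next
  fix x assume x: "x \<in> carrier (filtered_prod I M)"
    and all: "\<And>i. 1 \<le> i \<Longrightarrow> x \<in> filt (filtered_prod I M) i"
  show "x = \<zero>\<^bsub>filtered_prod I M\<^esub>"
    unfolding filtered_prod_simps
  proof (rule PiE_ext)
    show "x \<in> (\<Pi>\<^sub>E i\<in>I. carrier (M i))" using x by simp
    show "(\<lambda>i\<in>I. \<zero>\<^bsub>M i\<^esub>) \<in> (\<Pi>\<^sub>E i\<in>I. carrier (M i))"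
      using filtered_module.filt_zero[OF M, of _ 1] filtered_module.filt_1[OF M] by auto
    show "x i = (\<lambda>i\<in>I. \<zero>\<^bsub>M i\<^esub>) i" if "i \<in> I" for i
      using filtered_module.filt_separatedD[OF M[OF that], of "x i"] all that by auto
  qed
qed

lemma filtered_direct_sum_finite:
  "finite I \<Longrightarrow> filtered_direct_sum I M = filtered_prod I M"
  by (simp add: filtered_direct_sum_def filtered_prod_def)

text \<open>A bijective homomorphism need not be an isomorphism of filtered modules: its inverse respects
  the filtrations only if membership in each step is reflected as well as preserved.\<close>

lemma filtered_isomorphicI:
  fixes \<phi> :: "'n \<Rightarrow> 'm"
  assumes M: "filtered_module R M" and N: "filtered_module R N"
    and bij: "bij_betw \<phi> (carrier N) (carrier M)"
    and add: "\<And>x y. \<lbrakk>x \<in> carrier N; y \<in> carrier N\<rbrakk> \<Longrightarrow> \<phi> (x \<oplus>\<^bsub>N\<^esub> y) = \<phi> x \<oplus>\<^bsub>M\<^esub> \<phi> y"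
    and smult: "\<And>a x. \<lbrakk>a \<in> carrier R; x \<in> carrier N\<rbrakk> \<Longrightarrow> \<phi> (a \<odot>\<^bsub>N\<^esub> x) = a \<odot>\<^bsub>M\<^esub> \<phi> x"
    and filt: "\<And>i x. \<lbrakk>1 \<le> i; x \<in> carrier N\<rbrakk> \<Longrightarrow> \<phi> x \<in> filt M i \<longleftrightarrow> x \<in> filt N i"
  shows "filtered_isomorphic R M N"
proof -
  interpret M: filtered_module R M by fact
  interpret N: filtered_module R N by fact
  define \<psi> where "\<psi> = inv_into (carrier N) \<phi>"
  have \<phi>: "\<phi> x \<in> carrier M" if "x \<in> carrier N" for x
    using bij_betwE[OF bij] that by blast
  have \<psi>: "\<psi> y \<in> carrier N" if "y \<in> carrier M" for y
    unfolding \<psi>_def using bij_betwE[OF bij_betw_inv_into[OF bij]] that by blast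
  have \<psi>\<phi>: "\<psi> (\<phi> x) = x" if "x \<in> carrier N" for x
    unfolding \<psi>_def using bij that by (rule bij_betw_inv_into_left)
  have \<phi>\<psi>: "\<phi> (\<psi> y) = y" if "y \<in> carrier M" for y
    unfolding \<psi>_def using bij that by (rule bij_betw_inv_into_right)
  have "\<phi> \<in> filtered_hom R N M"
    unfolding filtered_hom_def
  proof (intro CollectI conjI ballI allI impI)
    show "\<phi> ` filt N i \<subseteq> filt M i" if "1 \<le> i" for i
      using filt[OF that] N.filt_closed[OF that] by auto
  qed (use \<phi> add smult in auto)
  moreover have "\<psi> \<in> filtered_hom R M N"
    unfolding filtered_hom_def
  proof (intro CollectI conjI ballI allI impI)
    fix x y assume xy: "x \<in> carrier M" "y \<in> carrier M"
    then have "\<psi> (x \<oplus>\<^bsub>M\<^esub> y) = \<psi> (\<phi> (\<psi> x \<oplus>\<^bsub>N\<^esub> \<psi> y))"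
      by (simp add: \<psi> \<phi>\<psi> add)
    then show "\<psi> (x \<oplus>\<^bsub>M\<^esub> y) = \<psi> x \<oplus>\<^bsub>N\<^esub> \<psi> y"
      using xy by (simp add: \<psi> \<psi>\<phi>)
  next
    fix a x assume ax: "a \<in> carrier R" "x \<in> carrier M"
    then have "\<psi> (a \<odot>\<^bsub>M\<^esub> x) = \<psi> (\<phi> (a \<odot>\<^bsub>N\<^esub> \<psi> x))"
      by (simp add: \<psi> \<phi>\<psi> smult)
    then show "\<psi> (a \<odot>\<^bsub>M\<^esub> x) = a \<odot>\<^bsub>N\<^esub> \<psi> x"
      using ax by (simp add: \<psi> \<psi>\<phi>)
  next
    fix i :: nat assume i: "1 \<le> i"
    show "\<psi> ` filt M i \<subseteq> filt N i"
      using filt[OF i \<psi>] M.filt_closed[OF i] \<phi>\<psi> by auto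
  qed (use \<psi> in auto)
  ultimately show ?thesis
    unfolding filtered_isomorphic_def using M N \<phi>\<psi> \<psi>\<phi> by blast
qed

lemma filtered_isomorphic_torsion_free:
  assumes iso: "filtered_isomorphic R M N" and a: "a \<in> carrier R"
    and N: "\<And>y. \<lbrakk>y \<in> carrier N; a \<odot>\<^bsub>N\<^esub> y = \<zero>\<^bsub>N\<^esub>\<rbrakk> \<Longrightarrow> y = \<zero>\<^bsub>N\<^esub>"
    and x: "x \<in> carrier M" "a \<odot>\<^bsub>M\<^esub> x = \<zero>\<^bsub>M\<^esub>"
  shows "x = \<zero>\<^bsub>M\<^esub>"
proof -
  obtain \<phi> \<psi> where \<phi>: "\<phi> \<in> filtered_hom R M N" and inv: "\<forall>x\<in>carrier M. \<psi> (\<phi> x) = x"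
    and "filtered_module R M" "filtered_module R N"
    using iso unfolding filtered_isomorphic_def by blast
  interpret M: filtered_module R M by fact
  interpret N: filtered_module R N by fact
  have closed: "\<phi> y \<in> carrier N" if "y \<in> carrier M" for y
    using \<phi> that unfolding filtered_hom_def by auto
  have "\<phi> (\<zero>\<^bsub>M\<^esub> \<oplus>\<^bsub>M\<^esub> \<zero>\<^bsub>M\<^esub>) = \<phi> \<zero>\<^bsub>M\<^esub> \<oplus>\<^bsub>N\<^esub> \<phi> \<zero>\<^bsub>M\<^esub>"
    using \<phi> M.M.zero_closed unfolding filtered_hom_def by blast
  then have zero: "\<phi> \<zero>\<^bsub>M\<^esub> = \<zero>\<^bsub>N\<^esub>"
    using closed[of "\<zero>\<^bsub>M\<^esub>"] by simp
  have "\<phi> (a \<odot>\<^bsub>M\<^esub> x) = a \<odot>\<^bsub>N\<^esub> \<phi> x"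
    using \<phi> x(1) a unfolding filtered_hom_def by blast
  then have "\<phi> x = \<zero>\<^bsub>N\<^esub>"
    using N[of "\<phi> x"] closed[OF x(1)] zero x(2) by simp
  then show ?thesis
    using inv zero x(1) by (metis M.M.zero_closed)
qed

section \<open>Shifts\<close>

definition shift :: "(nat \<Rightarrow> nat) \<Rightarrow> bool" where
  "shift \<rho> \<longleftrightarrow> strict_mono_on {1..} \<rho> \<and> 1 < \<rho> 1"

lemma shift_greater:
  assumes "shift \<rho>" "1 \<le> n"
  shows "n < \<rho> n"
  using assms(2)
proof (induction n rule: dec_induct)
  case base
  then show ?case using assms(1) by (simp add: shift_def)
next
  case (step n)
  moreover have "\<rho> n < \<rho> (Suc n)"
    using assms(1) step(1) strict_mono_onD[of "{1..}" \<rho> n "Suc n"] by (simp add: shift_def)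
  ultimately show ?case by simp
qed

lemma shift_inj_on: "shift \<rho> \<Longrightarrow> inj_on \<rho> {1..}"
  by (simp add: shift_def strict_mono_on_imp_inj_on)

lemma shift_funpow_ge:
  assumes "shift \<rho>" "1 \<le> n"
  shows "n + k \<le> (\<rho> ^^ k) n"
proof (induction k)
  case (Suc k)
  have "(\<rho> ^^ k) n < \<rho> ((\<rho> ^^ k) n)"
    using Suc assms by (intro shift_greater) auto
  then show ?case using Suc by simp
qed simp

lemma shift_funpow_strict_mono:
  assumes "shift \<rho>" "1 \<le> n" "j < k"
  shows "(\<rho> ^^ j) n < (\<rho> ^^ k) n"
proof -
  have "(\<rho> ^^ j) n < (\<rho> ^^ j) n + (k - j)" using assms(3) by simp
  also have "\<dots> \<le> (\<rho> ^^ (k - j)) ((\<rho> ^^ j) n)"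
    using shift_funpow_ge[OF assms(1,2), of j] assms(2) by (intro shift_funpow_ge assms) auto
  also have "\<dots> = (\<rho> ^^ k) n"
    using assms(3) by (simp flip: funpow_add comp_apply[of "\<rho> ^^ (k - j)" "\<rho> ^^ j"])
  finally show ?thesis .
qed

lemma shift_funpow_mono:
  "\<lbrakk>shift \<rho>; 1 \<le> n; j \<le> k\<rbrakk> \<Longrightarrow> (\<rho> ^^ j) n \<le> (\<rho> ^^ k) n"
  using shift_funpow_strict_mono[of \<rho> n j k] by (cases "j = k") auto

text \<open>Going backwards along a shift strictly decreases, so from every positive integer one arrives
  after finitely many steps at an element outside the image; injectivity makes the path unique.\<close>

lemma shift_orbits:
  assumes "shift \<rho>"
  shows "bij_betw (\<lambda>(i, k). (\<rho> ^^ k) i) (shift_compl \<rho> \<times> UNIV) {1..}"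
  unfolding bij_betw_def
proof
  have ge1: "1 \<le> (\<rho> ^^ k) i" if "i \<in> shift_compl \<rho>" for i k
    using shift_funpow_ge[OF assms, of i k] that by (simp add: shift_compl_def)
  have eq: "i = i' \<and> k = k'" if "i \<in> shift_compl \<rho>" "i' \<in> shift_compl \<rho>"
    and "(\<rho> ^^ k) i = (\<rho> ^^ k') i'" for i i' k k'
    using that(3)
  proof (induction k arbitrary: k')
    case 0
    then show ?case
      using that(1) ge1[OF that(2)] by (cases k') (auto simp: shift_compl_def)
  next
    case (Suc k)
    show ?case
    proof (cases k')
      case 0
      then show ?thesis using Suc.prems that(2) ge1[OF that(1), of k] by (force simp: shift_compl_def)
    next
      case (Suc l)
      then have "(\<rho> ^^ k) i = (\<rho> ^^ l) i'"
        using Suc.prems inj_onD[OF shift_inj_on[OF assms]] ge1 that(1,2) by auto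
      then show ?thesis using Suc.IH Suc by simp
    qed
  qed
  show "inj_on (\<lambda>(i, k). (\<rho> ^^ k) i) (shift_compl \<rho> \<times> UNIV)"
    by (rule inj_onI) (auto dest: eq)
  have "\<exists>i\<in>shift_compl \<rho>. \<exists>k. n = (\<rho> ^^ k) i" if "1 \<le> n" for n
    using that
  proof (induction n rule: less_induct)
    case (less n)
    show ?case
    proof (cases "n \<in> shift_compl \<rho>")
      case True
      then show ?thesis by (metis funpow_0)
    next
      case False
      then obtain m where m: "1 \<le> m" "n = \<rho> m"
        using less.prems by (auto simp: shift_compl_def)
      then have "m < n" using shift_greater[OF assms] by simp
      then obtain i k where "i \<in> shift_compl \<rho>" "m = (\<rho> ^^ k) i"
        using less.IH m(1) by blast
      then show ?thesis using m(2) by (intro bexI exI[of _ "Suc k"]) auto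
    qed
  qed
  then show "(\<lambda>(i, k). (\<rho> ^^ k) i) ` (shift_compl \<rho> \<times> UNIV) = {1..}"
    using ge1 by (auto simp: image_iff)
qed

lemma rho_simps [simp]:
  "rho (enat e) p i = min (i + e) (p * i)"
  "rho \<infinity> p i = p * i"
  by (simp_all add: rho_def)

lemma shift_rho:
  assumes "1 < p" "e \<noteq> 0"
  shows "shift (rho e p)"
proof (cases e)
  case (enat n)
  then have "0 < n" using assms(2) by (simp add: enat_0_iff)
  moreover have "min (r + n) (p * r) < min (s + n) (p * s)" if "r < s" for r s
    using mult_strict_left_mono[OF that, of p] that assms(1) by linarith
  ultimately show ?thesis
    using assms(1) enat by (auto simp: shift_def strict_mono_on_def)
next
  case infinity
  then show ?thesis using assms(1) by (auto simp: shift_def strict_mono_on_def)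
qed

section \<open>The standard filtered modules\<close>

lemma std_filtered_simps [simp]:
  "carrier (std_filtered p \<rho> i) = carrier (Zp p)"
  "zero (std_filtered p \<rho> i) = \<zero>\<^bsub>Zp p\<^esub>"
  "add (std_filtered p \<rho> i) = add (Zp p)"
  "smult (std_filtered p \<rho> i) = mult (Zp p)"
  by (simp_all add: std_filtered_def)

lemma le_std_weight_iff:
  assumes "shift \<rho>" "p > 0" "1 \<le> i" "x \<in> carrier (Zp p)"
  shows "enat j \<le> std_weight p \<rho> i x \<longleftrightarrow> (\<forall>k. (\<rho> ^^ k) i < j \<longrightarrow> x (Suc k) = 0)"
proof (cases "x = \<zero>\<^bsub>Zp p\<^esub>")
  case True
  then show ?thesis by (simp add: std_weight_def)
next
  case False
  note ord = le_ord_p_iff[OF assms(2,4) False]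
  have "j \<le> (\<rho> ^^ ord_p p x) i \<longleftrightarrow> (\<forall>k. (\<rho> ^^ k) i < j \<longrightarrow> Suc k \<le> ord_p p x)"
  proof (intro iffI allI impI)
    fix k assume "j \<le> (\<rho> ^^ ord_p p x) i" "(\<rho> ^^ k) i < j"
    then show "Suc k \<le> ord_p p x"
      using shift_funpow_mono[OF assms(1,3), of "ord_p p x" k] by linarith
  next
    assume "\<forall>k. (\<rho> ^^ k) i < j \<longrightarrow> Suc k \<le> ord_p p x"
    then show "j \<le> (\<rho> ^^ ord_p p x) i"
      by (metis Suc_n_not_le_n leI)
  qed
  then show ?thesis
    using False by (simp add: std_weight_def ord del: Zp_simps)
qed

text \<open>In this form, closure of the steps under addition and scalars is immediate, because the ring
  operations act on each residue separately.\<close>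

lemma std_filtered_filt_iff:
  assumes "shift \<rho>" "p > 0" "1 \<le> i"
  shows "x \<in> filt (std_filtered p \<rho> i) j \<longleftrightarrow>
    x \<in> carrier (Zp p) \<and> (\<forall>k. (\<rho> ^^ k) i < j \<longrightarrow> x (Suc k) = 0)"
  using le_std_weight_iff[OF assms] by (auto simp: std_filtered_def)

text \<open>The positions \<open>k\<close> concerned form an initial segment, and residues vanish along an initial segment
  exactly when the digits do.\<close>

lemma std_filtered_filt_iff_digits:
  assumes "shift \<rho>" "p > 0" "1 \<le> i" and x: "x \<in> carrier (Zp p)"
  shows "x \<in> filt (std_filtered p \<rho> i) j \<longleftrightarrow> (\<forall>k. (\<rho> ^^ k) i < j \<longrightarrow> Zp_digit p x k = 0)"
  unfolding std_filtered_filt_iff[OF assms(1-3)]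
proof (intro iffI conjI allI impI x)
  assume "x \<in> carrier (Zp p) \<and> (\<forall>k. (\<rho> ^^ k) i < j \<longrightarrow> x (Suc k) = 0)"
  then show "Zp_digit p x k = 0" if "(\<rho> ^^ k) i < j" for k
    using that by (simp add: Zp_digit_def)
next
  fix k assume digits: "\<forall>k. (\<rho> ^^ k) i < j \<longrightarrow> Zp_digit p x k = 0" and k: "(\<rho> ^^ k) i < j"
  have "Zp_digit p x l = 0" if "l < Suc k" for l
    using shift_funpow_mono[OF assms(1,3), of l k] digits k that by auto
  then have "nat (x (Suc k)) = 0"
    unfolding Zp_digit_expansion[OF x] by simp
  then show "x (Suc k) = 0"
    using Zp_nonneg[OF x, of "Suc k"] by simp
qed

lemma filtered_module_std:
  assumes "shift \<rho>" "p > 0" "1 \<le> i"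
  shows "filtered_module (Zp p) (std_filtered p \<rho> i)"
proof (rule filtered_moduleI)
  interpret Z: cring "Zp p" by (rule Zp_cring) fact
  note filt = std_filtered_filt_iff[OF assms]
  show "Module.module (Zp p) (std_filtered p \<rho> i)"
  proof (rule moduleI)
    show "abelian_group (std_filtered p \<rho> i)"
      by (rule abelian_groupI, unfold std_filtered_simps)
        (auto simp del: Zp_simps simp: Z.a_assoc intro: Z.a_comm Z.l_neg)
  qed (unfold std_filtered_simps, simp_all only: Z.l_distr Z.r_distr Z.m_assoc Z.m_closed Z.l_one Z.is_cring)
  show "filt (std_filtered p \<rho> i) 1 = carrier (std_filtered p \<rho> i)"
  proof -
    have [simp]: "(\<rho> ^^ k) i \<noteq> 0" for k
      using shift_funpow_ge[OF assms(1,3), of k] assms(3) by simp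
    show ?thesis by (auto simp: filt)
  qed
  show "filt (std_filtered p \<rho> i) (Suc j) \<subseteq> filt (std_filtered p \<rho> i) j" for j
    by (auto simp: filt)
  show "\<zero>\<^bsub>std_filtered p \<rho> i\<^esub> \<in> filt (std_filtered p \<rho> i) j" for j
    using Z.zero_closed by (auto simp: filt)
  show "x \<oplus>\<^bsub>std_filtered p \<rho> i\<^esub> y \<in> filt (std_filtered p \<rho> i) j"
    if "x \<in> filt (std_filtered p \<rho> i) j" "y \<in> filt (std_filtered p \<rho> i) j" for j x y
    using that Z.a_closed[of x y] by (auto simp: filt)
  show "a \<odot>\<^bsub>std_filtered p \<rho> i\<^esub> x \<in> filt (std_filtered p \<rho> i) j"
    if "a \<in> carrier (Zp p)" "x \<in> filt (std_filtered p \<rho> i) j" for j a x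
    using that Z.m_closed[of a x] by (auto simp: filt)
  show "x = \<zero>\<^bsub>std_filtered p \<rho> i\<^esub>"
    if x: "x \<in> carrier (std_filtered p \<rho> i)" and all: "\<And>j. 1 \<le> j \<Longrightarrow> x \<in> filt (std_filtered p \<rho> i) j" for x
  proof -
    have "x (Suc k) = 0" for k
      using all[of "Suc ((\<rho> ^^ k) i)"] unfolding filt by auto
    then show ?thesis using x Zp_zero_iff[of x p] by simp
  qed
qed

lemma M_shift_pow_eq:
  "M_shift_pow p \<rho> f = filtered_prod {..<f} (\<lambda>_. filtered_prod (shift_compl \<rho>) (std_filtered p \<rho>))"
  by (simp add: M_shift_pow_def M_shift_def filtered_direct_sum_finite)

lemma filtered_module_M_shift_pow:
  assumes "shift \<rho>" "p > 0"
  shows "filtered_module (Zp p) (M_shift_pow p \<rho> f)"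
  unfolding M_shift_pow_eq
  by (intro filtered_module_prod Zp_cring filtered_module_std assms) (simp add: shift_compl_def)

lemma M_shift_pow_filt_iff:
  assumes "shift \<rho>" "p > 0" and x: "x \<in> carrier (M_shift_pow p \<rho> f)"
  shows "x \<in> filt (M_shift_pow p \<rho> f) n \<longleftrightarrow>
    (\<forall>j<f. \<forall>i\<in>shift_compl \<rho>. \<forall>k. (\<rho> ^^ k) i < n \<longrightarrow> Zp_digit p (x j i) k = 0)"
proof -
  have "x j i \<in> filt (std_filtered p \<rho> i) n \<longleftrightarrow> (\<forall>k. (\<rho> ^^ k) i < n \<longrightarrow> Zp_digit p (x j i) k = 0)"
    if "j < f" "i \<in> shift_compl \<rho>" for i j
    using std_filtered_filt_iff_digits[OF assms(1,2)] x that
    by (simp add: M_shift_pow_eq shift_compl_def PiE_iff)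
  then show ?thesis
    using x by (simp add: M_shift_pow_eq PiE_iff Ball_def)
qed

lemma M_shift_pow_torsion_free:
  assumes "p > 0" "x \<in> carrier (M_shift_pow p \<rho> f)"
    and "([p] \<cdot>\<^bsub>Zp p\<^esub> \<one>\<^bsub>Zp p\<^esub>) \<odot>\<^bsub>M_shift_pow p \<rho> f\<^esub> x = \<zero>\<^bsub>M_shift_pow p \<rho> f\<^esub>"
  shows "x = \<zero>\<^bsub>M_shift_pow p \<rho> f\<^esub>"
proof -
  have "x j i = \<zero>\<^bsub>Zp p\<^esub>" if "j < f" "i \<in> shift_compl \<rho>" for i j
  proof (rule Zp_p_torsion_free[OF assms(1)])
    show "x j i \<in> carrier (Zp p)"
      using assms(2) that by (simp add: M_shift_pow_eq PiE_iff)
    show "([p] \<cdot>\<^bsub>Zp p\<^esub> \<one>\<^bsub>Zp p\<^esub>) \<otimes>\<^bsub>Zp p\<^esub> x j i = \<zero>\<^bsub>Zp p\<^esub>"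
      using fun_cong[OF fun_cong[OF assms(3), of j], of i] that
      by (simp add: M_shift_pow_eq del: Zp_simps)
  qed
  then have "x j = (\<lambda>i\<in>shift_compl \<rho>. \<zero>\<^bsub>Zp p\<^esub>)" if "j < f" for j
    using assms(2) that by (auto simp: M_shift_pow_eq PiE_iff extensional_def fun_eq_iff simp del: Zp_simps)
  then show ?thesis
    using assms(2) by (auto simp: M_shift_pow_eq PiE_iff extensional_def fun_eq_iff simp del: Zp_simps)
qed

section \<open>Non-archimedean fields\<close>

locale nonarch_field =
  fixes nm :: "'a::field \<Rightarrow> real"
  assumes nonarch: "nonarch_abs nm"
begin

lemma nm_nonneg [simp]: "0 \<le> nm x"
  and nm_eq_0 [simp]: "nm x = 0 \<longleftrightarrow> x = 0"
  and nm_mult: "nm (x * y) = nm x * nm y"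
  and nm_add: "nm (x + y) \<le> max (nm x) (nm y)"
  using nonarch unfolding nonarch_abs_def by blast+

lemma nm_0 [simp]: "nm 0 = 0"
  by simp

lemma nm_1 [simp]: "nm 1 = 1"
  using nm_mult[of 1 1] by simp

lemma nm_minus [simp]: "nm (- x) = nm x"
proof -
  have "nm (-1) ^ 2 = 1"
    using nm_mult[of "-1" "-1"] by (simp add: power2_eq_square)
  then have "nm (-1) = 1"
    using nm_nonneg[of "-1"] by (simp add: power2_eq_1_iff)
  then show ?thesis using nm_mult[of "-1" x] by simp
qed

lemma nm_diff: "nm (x - y) \<le> max (nm x) (nm y)"
  using nm_add[of x "- y"] by simp

lemma nm_diff_commute: "nm (x - y) = nm (y - x)"
  using nm_minus[of "x - y"] by simp

lemma nm_power: "nm (x ^ n) = nm x ^ n"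
  by (induction n) (simp_all add: nm_mult)

lemma nm_divide: "nm (x / y) = nm x / nm y"
  by (cases "y = 0") (use nm_mult[of "x / y" y] in \<open>simp_all add: field_simps\<close>)

lemma nm_of_nat: "nm (of_nat n) \<le> 1"
proof (induction n)
  case (Suc n)
  then show ?case using nm_add[of "of_nat n" 1] by (simp add: add.commute)
qed simp

lemma nm_sum: "(\<And>i. i \<in> A \<Longrightarrow> nm (g i) \<le> B) \<Longrightarrow> 0 \<le> B \<Longrightarrow> nm (sum g A) \<le> B"
proof (induction A rule: infinite_finite_induct)
  case (insert x A)
  then show ?case using nm_add[of "g x" "sum g A"] by fastforce
qed auto

lemma nm_add_dominant: "nm x < nm y \<Longrightarrow> nm (x + y) = nm y"
  using nm_add[of x y] nm_diff[of "x + y" x] by simp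

lemma Metric_space_nm: "Metric_space UNIV (\<lambda>x y. nm (x - y))"
proof
  show "nm (x - z) \<le> nm (x - y) + nm (y - z)" for x y z
    using nm_add[of "x - y" "y - z"] nm_nonneg[of "x - y"] nm_nonneg[of "y - z"] by (simp del: nm_nonneg)
qed (auto simp: nm_diff_commute)

lemma limitin_abs_topology_iff:
  "limitin (abs_topology nm) s l sequentially \<longleftrightarrow> (\<lambda>n. nm (s n - l)) \<longlonglongrightarrow> 0"
  unfolding abs_topology_def
  by (subst Metric_space.limitin_metric_dist_null[OF Metric_space_nm]) simp

lemma limitin_abs_topology_unique:
  assumes "limitin (abs_topology nm) s l sequentially" "limitin (abs_topology nm) s l' sequentially"
  shows "l = l'"
  using Metric_space.limitin_metric_unique[OF Metric_space_nm] assms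
  unfolding abs_topology_def by (metis sequentially_bot)

end

section \<open>Complete fields with a uniformizer\<close>

text \<open>A local field in the form used below: \<open>f\<close> is given by the number of residue classes, \<open>e\<close> by the
  absolute value of \<open>p\<close> with \<open>e = \<infinity>\<close> for characteristic \<open>p\<close>, and compactness by convergent
  subsequences in the ring of integers.\<close>

locale uniformized_field = nonarch_field nm
  for nm :: "'a::field \<Rightarrow> real" +
  fixes \<pi> :: 'a and p f :: nat and e :: enat
  assumes pi_pos: "0 < nm \<pi>" and pi_less_1: "nm \<pi> < 1"
    and value_group: "x \<noteq> 0 \<Longrightarrow> \<exists>k::int. nm x = nm \<pi> powi k"
    and int_seq_compact:
      "\<forall>n::nat. nm (s n) \<le> 1 \<Longrightarrow> \<exists>l r. strict_mono r \<and> (\<lambda>n. nm (s (r n) - l)) \<longlonglongrightarrow> 0"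
    \<comment> \<open>Qualified to tell primality of numbers from primality in a monoid.\<close>
    and prime_p: "normalization_semidom_class.prime p"
    and residue_card: "card ((\<lambda>x. {y. nm (x - y) < 1}) ` {x. nm x \<le> 1}) = p ^ f"
    and e_nonzero: "e \<noteq> 0"
    and nm_p: "nm (of_nat p) = (case e of enat n \<Rightarrow> nm \<pi> ^ n | \<infinity> \<Rightarrow> 0)"
begin

lemma p_gt_1: "1 < p"
  using prime_p by (rule prime_gt_1_nat)

abbreviation \<rho> :: "nat \<Rightarrow> nat" where "\<rho> \<equiv> rho e p"

lemma shift_\<rho>: "shift \<rho>"
  by (rule shift_rho[OF p_gt_1 e_nonzero])

subsection \<open>Powers of the maximal ideal\<close>

definition P :: "nat \<Rightarrow> 'a set" where "P n = {x. nm x \<le> nm \<pi> ^ n}"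

lemma P_0_iff: "x \<in> P 0 \<longleftrightarrow> nm x \<le> 1"
  by (simp add: P_def)

lemma zero_in_P [simp]: "0 \<in> P n"
  by (simp add: P_def)

lemma one_in_P_0 [simp]: "1 \<in> P 0"
  by (simp add: P_def)

lemma pi_power_in_P: "\<pi> ^ n \<in> P n"
  by (simp add: P_def nm_power)

lemma pi_power_anti_mono: "m \<le> n \<Longrightarrow> nm \<pi> ^ n \<le> nm \<pi> ^ m"
  using pi_pos pi_less_1 by (intro power_decreasing) auto

lemma P_mono: "m \<le> n \<Longrightarrow> x \<in> P n \<Longrightarrow> x \<in> P m"
  using pi_power_anti_mono[of m n] by (simp add: P_def)

lemma P_add: "x \<in> P n \<Longrightarrow> y \<in> P n \<Longrightarrow> x + y \<in> P n"
  using nm_add[of x y] by (auto simp: P_def)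

lemma P_minus_iff [simp]: "- x \<in> P n \<longleftrightarrow> x \<in> P n"
  by (simp add: P_def)

lemma P_diff: "x \<in> P n \<Longrightarrow> y \<in> P n \<Longrightarrow> x - y \<in> P n"
  using nm_diff[of x y] by (auto simp: P_def)

lemma P_mult: "x \<in> P m \<Longrightarrow> y \<in> P n \<Longrightarrow> x * y \<in> P (m + n)"
  by (auto simp: P_def nm_mult power_add intro: mult_mono)

lemma P_mult_left: "nm x \<le> 1 \<Longrightarrow> y \<in> P n \<Longrightarrow> x * y \<in> P n"
  using P_mult[of x 0 y n] by (simp add: P_0_iff)

lemma P_power: "x \<in> P n \<Longrightarrow> x ^ k \<in> P (k * n)"
  by (induction k) (simp_all add: P_mult)

lemma P_separated:
  assumes "\<And>n. x \<in> P n"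
  shows "x = 0"
proof -
  have "nm x \<le> 0"
  proof (rule LIMSEQ_le_const)
    show "(\<lambda>n. nm \<pi> ^ n) \<longlonglongrightarrow> 0"
      using pi_pos pi_less_1 by (intro LIMSEQ_realpow_zero) auto
    show "\<exists>N. \<forall>n\<ge>N. nm x \<le> nm \<pi> ^ n"
      using assms by (simp add: P_def)
  qed
  then show ?thesis by (metis nm_eq_0 nm_nonneg order_antisym)
qed

text \<open>The absolute value takes no value strictly between consecutive powers of \<open>nm \<pi>\<close>.\<close>

lemma P_next:
  assumes "x \<in> P n" "nm x \<noteq> nm \<pi> ^ n"
  shows "x \<in> P (Suc n)"
proof (cases "x = 0")
  case False
  then obtain k :: int where k: "nm x = nm \<pi> powi k"
    using value_group by blast
  have "\<not> k \<le> int n"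
  proof
    assume "k \<le> int n"
    then have "nm \<pi> powi int n \<le> nm \<pi> powi k"
      using pi_pos pi_less_1 by (intro power_int_decreasing) auto
    then show False using assms k by (simp add: P_def)
  qed
  then have "nm \<pi> powi k \<le> nm \<pi> powi int (Suc n)"
    using pi_pos pi_less_1 by (intro power_int_decreasing) auto
  then show ?thesis using k by (simp only: P_def power_int_of_nat mem_Collect_eq)
qed simp

lemma P_Suc_0_iff: "x \<in> P (Suc 0) \<longleftrightarrow> nm x < 1"
  using P_next[of x 0] pi_less_1 by (auto simp: P_def)

lemma P_telescope:
  assumes "\<And>k. s (Suc k) - s k \<in> P k" "k \<le> m"
  shows "s m - s k \<in> P k"
  using assms(2)
proof (induction m rule: dec_induct)
  case (step m)
  then show ?case using P_add[OF P_mono[OF step(1) assms(1)] step.IH] by simp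
qed simp

text \<open>Compactness yields a convergent subsequence, and the congruences force the whole sequence to follow it.\<close>

lemma P_complete:
  assumes step: "\<And>k. s (Suc k) - s k \<in> P k" and "s 0 \<in> P 0"
  shows "\<exists>l. \<forall>k. s k - l \<in> P k"
proof -
  have "s n \<in> P 0" for n
    using P_add[OF P_telescope[OF step, of 0 n] assms(2)] by simp
  then have "\<forall>n. nm (s n) \<le> 1"
    by (simp add: P_0_iff)
  from int_seq_compact[OF this]
  obtain l r where r: "strict_mono r" and lim: "(\<lambda>n. nm (s (r n) - l)) \<longlonglongrightarrow> 0"
    by blast
  have "s k - l \<in> P k" for k
  proof -
    have "eventually (\<lambda>n. nm (s (r n) - l) < nm \<pi> ^ k) sequentially"
      using order_tendstoD(2)[OF lim] pi_pos by simp
    then obtain N where N: "\<And>n. N \<le> n \<Longrightarrow> nm (s (r n) - l) < nm \<pi> ^ k"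
      by (auto simp: eventually_sequentially)
    define n where "n = max N k"
    have n: "nm (s (r n) - l) < nm \<pi> ^ k" "k \<le> n"
      using N[of n] by (simp_all add: n_def)
    have "s (r n) - s k \<in> P k"
      using n(2) seq_suble[OF r, of n] by (intro P_telescope[of s, OF step]) simp
    moreover have "s (r n) - l \<in> P k"
      using n(1) by (simp add: P_def)
    ultimately show ?thesis
      using P_diff[of "s (r n) - l" k "s (r n) - s k"] by simp
  qed
  then show ?thesis by blast
qed

lemma P_limit_unique:
  assumes "\<And>k. s k - l \<in> P k" "\<And>k. s k - l' \<in> P k"
  shows "l = l'"
proof -
  have "l' - l \<in> P k" for k
    using P_diff[OF assms(1) assms(2), of k] by simp
  then show ?thesis using P_separated by force
qed

subsection \<open>Congruences modulo powers of the maximal ideal\<close>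

definition congr :: "nat \<Rightarrow> 'a \<Rightarrow> 'a \<Rightarrow> bool" where "congr n x y \<longleftrightarrow> x - y \<in> P n"

lemma congr_refl [simp]: "congr n x x"
  by (simp add: congr_def)

lemma congr_sym: "congr n x y \<Longrightarrow> congr n y x"
  unfolding congr_def by (metis P_minus_iff minus_diff_eq)

lemma congr_trans [trans]: "congr n x y \<Longrightarrow> congr n y z \<Longrightarrow> congr n x z"
  unfolding congr_def using P_add[of "x - y" n "y - z"] by simp

lemma congr_mono: "m \<le> n \<Longrightarrow> congr n x y \<Longrightarrow> congr m x y"
  unfolding congr_def by (rule P_mono)

text \<open>The bounds are asymmetric because \<open>x * y - x' * y' = y * (x - x') + x' * (y - y')\<close>.\<close>

lemma congr_mult:
  assumes "congr n x x'" "congr n y y'" "nm x' \<le> 1" "nm y \<le> 1"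
  shows "congr n (x * y) (x' * y')"
proof -
  have "x * y - x' * y' = y * (x - x') + x' * (y - y')"
    by (simp add: algebra_simps)
  then show ?thesis
    using assms unfolding congr_def by (simp add: P_add P_mult_left)
qed

definition U :: "nat \<Rightarrow> 'a set" where "U n = {x. congr n x 1}"

lemma U_iff: "x \<in> U n \<longleftrightarrow> x - 1 \<in> P n"
  by (simp add: U_def congr_def)

lemma U_mono: "m \<le> n \<Longrightarrow> x \<in> U n \<Longrightarrow> x \<in> U m"
  unfolding U_iff by (rule P_mono)

lemma one_in_U [simp]: "1 \<in> U n"
  by (simp add: U_iff)

lemma nm_principal_unit: "x \<in> U (Suc 0) \<Longrightarrow> nm x = 1"
  using nm_add_dominant[of "x - 1" 1] by (simp add: U_iff P_Suc_0_iff)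

lemma principal_unit_nonzero: "x \<in> U (Suc 0) \<Longrightarrow> x \<noteq> 0"
  using nm_principal_unit by fastforce

lemma U_principal: "1 \<le> n \<Longrightarrow> x \<in> U n \<Longrightarrow> x \<in> U (Suc 0)"
  using U_mono[of "Suc 0" n] by simp

lemma U_mult: "1 \<le> n \<Longrightarrow> x \<in> U n \<Longrightarrow> y \<in> U n \<Longrightarrow> x * y \<in> U n"
  using congr_mult[of n x 1 y 1] nm_principal_unit[OF U_principal, of n y] by (simp add: U_def)

lemma U_power: "1 \<le> n \<Longrightarrow> x \<in> U n \<Longrightarrow> x ^ k \<in> U n"
  by (induction k) (simp_all add: U_mult)

lemma U_prod: "1 \<le> n \<Longrightarrow> (\<And>i. i \<in> A \<Longrightarrow> g i \<in> U n) \<Longrightarrow> prod g A \<in> U n"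
  by (induction A rule: infinite_finite_induct) (simp_all add: U_mult)

lemma U_divide_iff:
  assumes "x \<in> U (Suc 0)" "y \<in> U (Suc 0)"
  shows "x / y \<in> U n \<longleftrightarrow> congr n x y"
proof -
  have "nm (x / y - 1) = nm (x - y)"
    using nm_divide[of "x - y" y] nm_principal_unit[OF assms(2)] principal_unit_nonzero[OF assms(2)]
    by (simp add: diff_divide_distrib)
  then show ?thesis by (simp add: U_iff congr_def P_def)
qed

lemma U_divide: "\<lbrakk>1 \<le> n; x \<in> U n; y \<in> U n\<rbrakk> \<Longrightarrow> x / y \<in> U n"
  using U_divide_iff[of x y n] U_principal[of n] by (auto simp: U_def intro: congr_trans congr_sym)

lemma congr_units_mult:
  assumes "x' \<in> U (Suc 0)" "y \<in> U (Suc 0)" "congr n x x'" "congr n y y'"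
  shows "congr n (x * y) (x' * y')"
  using congr_mult[OF assms(3,4)] assms(1,2) by (simp add: nm_principal_unit)

lemma congr_units_power:
  assumes "x \<in> U (Suc 0)" "y \<in> U (Suc 0)" "congr n x y"
  shows "congr n (x ^ k) (y ^ k)"
  by (induction k) (simp_all add: congr_units_mult U_power assms)

lemma congr_units_prod:
  assumes "\<And>i. i \<in> A \<Longrightarrow> g i \<in> U (Suc 0)" "\<And>i. i \<in> A \<Longrightarrow> h i \<in> U (Suc 0)"
    and "\<And>i. i \<in> A \<Longrightarrow> congr n (g i) (h i)"
  shows "congr n (prod g A) (prod h A)"
  using assms by (induction A rule: infinite_finite_induct) (auto intro!: congr_units_mult U_prod)

lemma congr_in_U: "congr n x y \<Longrightarrow> y \<in> U n \<Longrightarrow> x \<in> U n"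
  unfolding U_def by (auto intro: congr_trans)

lemma congr_absorb_right:
  assumes "x \<in> U (Suc 0)" "y \<in> U n" "1 \<le> n"
  shows "congr n (x * y) x"
  using congr_units_mult[of x y n x 1] assms U_principal[OF assms(3,2)] by (simp add: U_def)

section \<open>Raising principal units to the power \<open>p\<close>\<close>

text \<open>All inner binomial coefficients are divisible by \<open>p\<close>, so near 1 the map \<open>1 + y \<mapsto> (1 + y) ^ p\<close> is
  governed by the two terms \<open>y ^ p\<close> and \<open>p * y\<close>.\<close>

lemma p_power_expansion:
  assumes "nm y \<le> 1"
  shows "\<exists>r. nm r \<le> 1 \<and> (1 + y) ^ p = 1 + y ^ p + of_nat p * y * (1 + y * r)"
proof -
  define r where "r = (\<Sum>k\<in>{2..<p}. of_nat ((p choose k) div p) * y ^ (k - 2))"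
  have "nm r \<le> 1"
    unfolding r_def
    using assms nm_of_nat by (intro nm_sum) (auto simp: nm_mult nm_power intro!: mult_le_one power_le_one)
  moreover have "(1 + y) ^ p = 1 + y ^ p + of_nat p * y * (1 + y * r)"
  proof -
    have split: "{..p} = insert 0 (insert 1 (insert p {2..<p}))"
      using p_gt_1 by auto
    have "(1 + y) ^ p = (\<Sum>k\<le>p. of_nat (p choose k) * y ^ k)"
      using binomial_ring[of y 1 p] by (simp add: add.commute)
    also have "\<dots> = 1 + y ^ p + of_nat p * y + (\<Sum>k\<in>{2..<p}. of_nat (p choose k) * y ^ k)"
      unfolding split using p_gt_1 by (simp add: add_ac)
    also have "(\<Sum>k\<in>{2..<p}. of_nat (p choose k) * y ^ k) = of_nat p * y * (y * r)"
      unfolding r_def sum_distrib_left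
    proof (rule sum.cong)
      fix k assume k: "k \<in> {2..<p}"
      then have "p dvd (p choose k)"
        using prime_p by (intro dvd_choose_prime) auto
      then have "of_nat (p choose k) = (of_nat p * of_nat ((p choose k) div p) :: 'a)"
        by (simp flip: of_nat_mult)
      moreover have "2 + (k - 2) = k"
        using k by auto
      then have "y ^ k = y * y * y ^ (k - 2)"
        using power_add[of y 2 "k - 2"] by (simp only: power2_eq_square)
      ultimately show "of_nat (p choose k) * y ^ k
          = of_nat p * y * (y * (of_nat ((p choose k) div p) * y ^ (k - 2)))"
        by (simp add: mult_ac)
    qed simp
    finally show ?thesis by (simp add: algebra_simps)
  qed
  ultimately show ?thesis by blast
qed

lemma p_mult_in_P:
  assumes "y \<in> P n" "enat m \<le> enat n + e"
  shows "of_nat p * y \<in> P m"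
proof (cases e)
  case (enat d)
  then have "of_nat p \<in> P d"
    using nm_p by (simp add: P_def)
  then have "of_nat p * y \<in> P (d + n)"
    using assms(1) by (rule P_mult)
  then show ?thesis
    using assms(2) enat by (intro P_mono[of m "d + n"]) auto
next
  case infinity
  then have "of_nat p = (0::'a)"
    using nm_p by simp
  then show ?thesis by simp
qed

lemma rho_le: "\<rho> n \<le> p * n" "enat (\<rho> n) \<le> enat n + e"
  by (cases e; simp)+

text \<open>The value \<open>\<rho> n = min (n + e) (p * n)\<close> is the smaller of the levels of \<open>p * y\<close> and \<open>y ^ p\<close> when \<open>y\<close>
  has level \<open>n\<close>.\<close>

lemma U_p_power:
  assumes "1 \<le> n" "x \<in> U n"
  shows "x ^ p \<in> U (\<rho> n)"
proof -
  define y where "y = x - 1"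
  have y: "y \<in> P n" using assms(2) by (simp add: U_iff y_def)
  then have y0: "nm y \<le> 1"
    using P_mono[of 0 n y] by (simp add: P_0_iff)
  then obtain r where r: "nm r \<le> 1" "(1 + y) ^ p = 1 + y ^ p + of_nat p * y * (1 + y * r)"
    using p_power_expansion by blast
  have "nm (1 + y * r) \<le> 1"
    using nm_add[of 1 "y * r"] y0 r(1) mult_le_one[of "nm y" "nm r"] by (simp add: nm_mult)
  moreover have "y ^ p \<in> P (\<rho> n)"
    using P_power[OF y, of p] rho_le(1) P_mono by blast
  moreover have "of_nat p * y \<in> P (\<rho> n)"
    by (rule p_mult_in_P[OF y rho_le(2)])
  ultimately have "y ^ p + (1 + y * r) * (of_nat p * y) \<in> P (\<rho> n)"
    by (auto intro: P_add P_mult_left)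
  then show ?thesis
    using r(2) by (simp add: U_iff y_def mult_ac)
qed

lemma U_p_power_iterate:
  assumes "1 \<le> n" "x \<in> U n"
  shows "x ^ (p ^ k) \<in> U ((\<rho> ^^ k) n)"
proof (induction k)
  case (Suc k)
  have "1 \<le> (\<rho> ^^ k) n"
    using shift_funpow_ge[OF shift_\<rho> assms(1), of k] assms(1) by simp
  then have "(x ^ (p ^ k)) ^ p \<in> U (\<rho> ((\<rho> ^^ k) n))"
    using Suc by (rule U_p_power)
  then show ?case by (simp flip: power_mult add: mult.commute)
qed (simp add: assms)

text \<open>When \<open>y ^ p\<close> and \<open>p * y\<close> have different absolute values, the larger one decides how far
  \<open>(1 + y) ^ p\<close> is from 1.\<close>

lemma nm_p_power_minus_1:
  assumes "1 \<le> n" "nm y = nm \<pi> ^ n" "enat (p * n) \<noteq> enat n + e"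
  shows "nm ((1 + y) ^ p - 1) = nm \<pi> ^ \<rho> n"
proof -
  have strict: "nm \<pi> ^ l < nm \<pi> ^ k" if "k < l" for k l
    using that pi_pos pi_less_1 by (rule power_strict_decreasing)
  have y1: "nm y < 1"
    using strict[of 0 n] assms by simp
  then obtain r where r: "nm r \<le> 1" "(1 + y) ^ p = 1 + y ^ p + of_nat p * y * (1 + y * r)"
    using p_power_expansion[of y] by auto
  have "nm (y * r) < 1"
    using y1 r(1) mult_left_le[of "nm r" "nm y"] by (simp add: nm_mult)
  then have unit: "nm (1 + y * r) = 1"
    using nm_add_dominant[of "y * r" 1] by (simp add: add.commute)
  have eq: "(1 + y) ^ p - 1 = y ^ p + of_nat p * y * (1 + y * r)"
    using r(2) by simp
  have A: "nm (y ^ p) = nm \<pi> ^ (p * n)"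
    by (simp add: nm_power assms(2) mult.commute flip: power_mult)
  show ?thesis
  proof (cases e)
    case (enat d)
    have B: "nm (of_nat p * y * (1 + y * r)) = nm \<pi> ^ (n + d)"
      using nm_p enat by (simp add: nm_mult unit assms(2) power_add)
    have "p * n < n + d \<or> n + d < p * n"
      using assms(3) enat by auto
    then show ?thesis
    proof
      assume less: "p * n < n + d"
      then show ?thesis
        using nm_add_dominant[of "of_nat p * y * (1 + y * r)" "y ^ p"] strict[OF less] A B enat eq
        by (simp add: add.commute min_def)
    next
      assume less: "n + d < p * n"
      then show ?thesis
        using nm_add_dominant[of "y ^ p" "of_nat p * y * (1 + y * r)"] strict[OF less] A B enat eq
        by (simp add: min_def)
    qed
  next
    case infinity
    then have "of_nat p = (0::'a)" using nm_p by simp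
    then show ?thesis using A eq infinity by simp
  qed
qed

text \<open>The one index where the two terms balance is \<open>n = d / (p - 1)\<close>.  Beyond it \<open>p * y\<close> dominates, so
  a Newton iteration extracts \<open>p\<close>-th roots.\<close>

lemma p_th_root:
  assumes e: "e = enat d" and n: "1 \<le> n" "p * n = n + d" and t: "t \<in> U (Suc (p * n))"
  shows "\<exists>z\<in>U (Suc n). z ^ p = t"
proof -
  have p0: "of_nat p \<noteq> (0::'a)"
    using nm_p e pi_pos by (metis enat.simps(4) nm_0 power_not_zero less_irrefl)
  have p_cancel: "y / of_nat p \<in> P m" if "y \<in> P (m + d)" for y m
  proof -
    have "nm y \<le> nm \<pi> ^ m * nm \<pi> ^ d" using that by (simp add: P_def power_add)
    then show ?thesis
      using nm_p e pi_pos by (simp add: P_def nm_divide field_simps)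
  qed
  \<comment> \<open>One Newton step for \<open>z ^ p = u\<close> starting at \<open>z = 1\<close> improves the approximation by a level.\<close>
  have approx: "congr (Suc m + d) ((1 + (u - 1) / of_nat p) ^ p) u"
    if u: "u \<in> U (m + d)" and m: "n < m" for u m
  proof -
    define y where "y = (u - 1) / of_nat p"
    have y: "y \<in> P m" using p_cancel u by (simp add: y_def U_iff)
    then have "nm y \<le> 1" using P_mono[of 0 m y] by (simp add: P_0_iff)
    then obtain r where r: "nm r \<le> 1" "(1 + y) ^ p = 1 + y ^ p + of_nat p * y * (1 + y * r)"
      using p_power_expansion by blast
    have py: "of_nat p * y = u - 1" using p0 by (simp add: y_def)
    have "(1 + y) ^ p - u = y ^ p + r * ((of_nat p * y) * y)"
      using r(2) unfolding distrib_left py by (simp add: algebra_simps)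
    moreover have "y ^ p \<in> P (Suc m + d)"
    proof (rule P_mono[OF _ P_power[OF y]])
      obtain q where q: "p = Suc q" "0 < q" using p_gt_1 by (cases p) auto
      then have "q * n = d" using n(2) by simp
      then have "d < q * m" using mult_strict_left_mono[OF m q(2)] by simp
      then show "Suc m + d \<le> p * m" using q by simp
    qed
    moreover have "(of_nat p * y) * y \<in> P (Suc m + d)"
    proof (rule P_mono)
      show "(of_nat p * y) * y \<in> P (m + d + m)"
        using P_mult[of "of_nat p * y" "m + d" y m] u y py by (simp add: U_iff)
    qed (use m in auto)
    ultimately show ?thesis
      using r(1) unfolding congr_def y_def[symmetric] by (simp add: P_add P_mult_left)
  qed
  define z where "z = rec_nat 1 (\<lambda>_ w. w * (1 + (t / w ^ p - 1) / of_nat p))"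
  have z_0: "z 0 = 1" and z_Suc: "z (Suc k) = z k * (1 + (t / z k ^ p - 1) / of_nat p)" for k
    by (simp_all add: z_def)
  have t1: "t \<in> U (Suc 0)" using t by (rule U_mono[rotated]) simp
  \<comment> \<open>\<open>z\<close> iterates the step on the quotient \<open>t / z k ^ p\<close> that remains.\<close>
  have z: "z k \<in> U (Suc n) \<and> congr (Suc n + k + d) t (z k ^ p)" for k
  proof (induction k)
    case 0
    then show ?case using t n(2) by (simp add: z_0 U_def)
  next
    case (Suc k)
    define u where "u = t / z k ^ p"
    have zk: "z k \<in> U (Suc 0)" using Suc U_principal[of "Suc n"] by simp
    then have zp: "z k ^ p \<in> U (Suc 0)" by (simp add: U_power)
    have u: "u \<in> U (Suc n + k + d)"
      unfolding u_def using Suc U_divide_iff[OF t1 zp] by simp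
    define v where "v = 1 + (u - 1) / of_nat p"
    have v: "v \<in> U (Suc n + k)"
      using p_cancel[of "u - 1" "Suc n + k"] u unfolding v_def U_iff by simp
    have v1: "v \<in> U (Suc 0)" using v by (rule U_mono[rotated]) simp
    have zv: "z (Suc k) = z k * v" by (simp add: z_Suc v_def u_def)
    have "congr (Suc n + Suc k + d) (v ^ p) u"
      using approx[OF u] by (simp add: v_def)
    then have "congr (Suc n + Suc k + d) (z k ^ p * v ^ p) (z k ^ p * u)"
      using zp v1 by (intro congr_units_mult) (auto intro: U_power)
    moreover have "z k ^ p * u = t"
      using principal_unit_nonzero[OF zp] by (simp add: u_def)
    ultimately have "congr (Suc n + Suc k + d) t (z (Suc k) ^ p)"
      by (simp add: zv power_mult_distrib congr_sym)
    moreover have "z (Suc k) \<in> U (Suc n)"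
      unfolding zv using Suc U_mono[OF _ v, of "Suc n"] by (intro U_mult) auto
    ultimately show ?case by blast
  qed
  have z1: "z k \<in> U (Suc 0)" for k
    using z U_principal[of "Suc n"] by simp
  have "z (Suc k) - z k \<in> P k" for k
  proof -
    have zp: "z k ^ p \<in> U (Suc 0)" using z1 by (simp add: U_power)
    have "t / z k ^ p \<in> U (Suc n + k + d)"
      using z U_divide_iff[OF t1 zp] by simp
    then have "(t / z k ^ p - 1) / of_nat p \<in> P (Suc n + k)"
      using p_cancel[of _ "Suc n + k"] by (simp add: U_iff)
    then have "(t / z k ^ p - 1) / of_nat p \<in> P k"
      by (rule P_mono[rotated]) simp
    then have "z k * ((t / z k ^ p - 1) / of_nat p) \<in> P k"
      using nm_principal_unit[OF z1, of k] by (intro P_mult_left) simp_all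
    then show ?thesis
      by (simp add: z_Suc distrib_left)
  qed
  then obtain l where l: "\<And>k. congr k (z k) l"
    using P_complete[of z] z_0 unfolding congr_def by auto
  have lU: "l \<in> U (Suc n)"
    using congr_in_U[OF congr_sym[OF l]] z by blast
  then have l1: "l \<in> U (Suc 0)" using U_principal[of "Suc n"] by simp
  have "l ^ p - t \<in> P k" for k
  proof -
    have "congr k (z k ^ p) (l ^ p)"
      by (rule congr_units_power[OF z1 l1 l])
    moreover have "congr k t (z k ^ p)"
      using z by (auto intro: congr_mono[of k "Suc n + k + d"])
    ultimately have "congr k (l ^ p) t"
      by (blast intro: congr_trans congr_sym)
    then show ?thesis by (simp add: congr_def)
  qed
  then have "l ^ p = t"
    using P_separated[of "l ^ p - t"] by simp
  then show ?thesis using lU by blast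
qed

text \<open>At the balanced index, a unit of exact level \<open>n\<close> whose \<open>p\<close>-th power is too close to 1 has the same
  \<open>p\<close>-th power as some unit of higher level; their quotient is a nontrivial \<open>p\<close>-th root of unity.\<close>

lemma p_power_reflects_level:
  assumes mu: "mu p = {1::'a}" and n: "1 \<le> n" and x: "x \<in> U n" "x ^ p \<in> U (Suc (\<rho> n))"
  shows "x \<in> U (Suc n)"
proof (rule ccontr)
  assume notin: "x \<notin> U (Suc n)"
  have exact: "nm (x - 1) = nm \<pi> ^ n"
    using x(1) notin P_next by (auto simp: U_iff)
  show False
  proof (cases "enat (p * n) = enat n + e")
    case True
    then obtain d where d: "e = enat d" "p * n = n + d" by (cases e) auto
    then obtain z where z: "z \<in> U (Suc n)" "z ^ p = x ^ p"
      using p_th_root[OF d(1) n d(2), of "x ^ p"] x(2) by auto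
    have z0: "z \<noteq> 0" and x0: "x \<noteq> 0"
      using z(1) x(1) n U_principal principal_unit_nonzero by force+
    then have "x / z \<in> mu p"
      using z(2) by (simp add: mu_def power_divide)
    then have "x = z" using mu z0 by simp
    then show False using z(1) notin by simp
  next
    case False
    then have "nm (x ^ p - 1) = nm \<pi> ^ \<rho> n"
      using nm_p_power_minus_1[OF n exact] by simp
    moreover have "nm \<pi> ^ Suc (\<rho> n) < nm \<pi> ^ \<rho> n"
      using pi_pos pi_less_1 by simp
    ultimately show False using x(2) by (simp add: U_iff P_def)
  qed
qed

text \<open>Modulo the maximal ideal, \<open>(x - 1) ^ p\<close> agrees with \<open>x ^ p - 1\<close>.\<close>

lemma mu_subset_U: "mu p \<subseteq> U 1"
proof
  fix x :: 'a assume "x \<in> mu p"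
  then have x: "x ^ p = 1" by (simp add: mu_def)
  then have "nm x ^ p = 1" by (simp flip: nm_power)
  then have "nm x = 1"
    using p_gt_1 power_eq_iff_eq_base[of p "nm x" 1] by simp
  then have "nm (x - 1) \<le> 1" using nm_diff[of x 1] by simp
  then obtain r where r: "nm r \<le> 1"
    "(1 + (x - 1)) ^ p = 1 + (x - 1) ^ p + of_nat p * (x - 1) * (1 + (x - 1) * r)"
    using p_power_expansion by blast
  have "nm (1 + (x - 1) * r) \<le> 1"
    using nm_add[of 1 "(x - 1) * r"] \<open>nm (x - 1) \<le> 1\<close> r(1) mult_le_one[of "nm (x - 1)" "nm r"]
    by (simp add: nm_mult)
  moreover have "of_nat p * (x - 1) \<in> P 1"
  proof (rule p_mult_in_P)
    show "x - 1 \<in> P 0" using \<open>nm (x - 1) \<le> 1\<close> by (simp add: P_0_iff)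
    show "enat 1 \<le> enat 0 + e" using e_nonzero by (cases e) (auto simp: zero_enat_def)
  qed
  ultimately have "(1 + (x - 1) * r) * (of_nat p * (x - 1)) \<in> P 1"
    by (rule P_mult_left)
  moreover have "(x - 1) ^ p = - ((1 + (x - 1) * r) * (of_nat p * (x - 1)))"
    using r(2) x by (simp add: algebra_simps)
  ultimately have "(x - 1) ^ p \<in> P 1" by (metis P_minus_iff)
  then have "nm (x - 1) ^ p < 1"
    by (simp add: P_Suc_0_iff nm_power)
  then have "nm (x - 1) < 1"
    by (metis linorder_not_less one_le_power)
  then show "x \<in> U 1" by (simp add: U_iff P_Suc_0_iff)
qed

section \<open>Principal units as a filtered module\<close>

lemma limitin_abs_topology_congr:
  assumes "\<And>n. congr n (s n) l"
  shows "limitin (abs_topology nm) s l sequentially"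
  unfolding limitin_abs_topology_iff
proof (rule tendsto_sandwich[of "\<lambda>_. 0"])
  show "(\<lambda>n. nm \<pi> ^ n) \<longlonglongrightarrow> 0"
    using pi_pos pi_less_1 by (intro LIMSEQ_realpow_zero) auto
qed (use assms in \<open>auto simp: congr_def P_def\<close>)

lemma U_power_p_power:
  assumes "u \<in> U 1"
  shows "u ^ (p ^ n) \<in> U n"
  using shift_funpow_ge[OF shift_\<rho>, of 1 n] assms
  by (intro U_mono[OF _ U_p_power_iterate[of 1 u n]]) auto

text \<open>Since \<open>p ^ n\<close>-th powers of principal units lie in \<open>U n\<close>, only the residue of an exponent modulo \<open>p ^ n\<close>
  matters modulo \<open>P n\<close>.  This is what makes \<open>p\<close>-adic exponents meaningful.\<close>

lemma congr_power_mod: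
  assumes "u \<in> U 1"
  shows "congr n (u ^ (a mod p ^ n)) (u ^ a)"
proof (cases "n = 0")
  case True
  have "nm (u ^ k) = 1" for k
    using nm_principal_unit assms by (simp add: nm_power)
  then show ?thesis
    using True nm_diff[of "u ^ (a mod p ^ n)" "u ^ a"] by (simp add: congr_def P_0_iff le_max_iff_disj)
next
  case False
  have "u ^ a = u ^ (a mod p ^ n) * (u ^ (p ^ n)) ^ (a div p ^ n)"
    by (simp flip: power_mult power_add)
  moreover have "(u ^ (p ^ n)) ^ (a div p ^ n) \<in> U n"
    using False assms by (intro U_power U_power_p_power) auto
  ultimately show ?thesis
    using False assms by (auto intro!: congr_sym[OF congr_absorb_right] U_power)
qed

lemma Zp_nat_mod:
  assumes "a \<in> carrier (Zp p)" "n \<le> m"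
  shows "nat (a m) mod p ^ n = nat (a n)"
proof -
  have "int (nat (a m) mod p ^ n) = a m mod int p ^ n"
    using Zp_nonneg[OF assms(1)] by (simp add: zmod_int)
  then show ?thesis
    using Zp_compatible[OF assms] by simp
qed

lemma congr_Zp_power:
  assumes "a \<in> carrier (Zp p)" "u \<in> U 1" "n \<le> m"
  shows "congr n (u ^ nat (a n)) (u ^ nat (a m))"
  using congr_power_mod[OF assms(2), of n "nat (a m)"] Zp_nat_mod[OF assms(1,3)] by simp

lemma padic_pow_congr:
  assumes a: "a \<in> carrier (Zp p)" and u: "u \<in> U 1"
  shows "congr n (u ^ nat (a n)) (padic_pow nm a u)"
proof -
  have "\<exists>l. \<forall>k. u ^ nat (a k) - l \<in> P k"
  proof (rule P_complete)
    show "u ^ nat (a (Suc k)) - u ^ nat (a k) \<in> P k" for k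
      using congr_sym[OF congr_Zp_power[OF a u, of k "Suc k"]] by (simp add: congr_def)
    show "u ^ nat (a 0) \<in> P 0"
      using u nm_principal_unit by (simp add: P_0_iff nm_power)
  qed
  then obtain l where l: "\<And>k. congr k (u ^ nat (a k)) l"
    by (auto simp: congr_def)
  have "(\<lambda>n. u powi a n) = (\<lambda>n. u ^ nat (a n))"
    using Zp_nonneg[OF a] by (auto simp: power_int_def)
  then have "padic_pow nm a u = l"
    unfolding padic_pow_def
    using limitin_abs_topology_congr[OF l] limitin_abs_topology_unique by (intro the_equality) auto
  then show ?thesis using l by simp
qed

text \<open>Identities between \<open>p\<close>-adic powers reduce to identities between natural powers, checked modulo each
  \<open>P n\<close>.\<close>

lemma padic_pow_eqI:
  assumes "a \<in> carrier (Zp p)" "u \<in> U 1" "\<And>n. congr n (u ^ nat (a n)) l"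
  shows "padic_pow nm a u = l"
  using P_limit_unique[of "\<lambda>n. u ^ nat (a n)"] padic_pow_congr[OF assms(1,2)] assms(3)
  unfolding congr_def by blast

lemma padic_pow_in_U:
  assumes "a \<in> carrier (Zp p)" "1 \<le> n" "u \<in> U n"
  shows "padic_pow nm a u \<in> U n"
proof (rule congr_in_U)
  show "congr n (padic_pow nm a u) (u ^ nat (a n))"
    using padic_pow_congr[OF assms(1)] U_principal[OF assms(2,3)] congr_sym by simp
  show "u ^ nat (a n) \<in> U n"
    using assms by (intro U_power)
qed

lemma padic_pow_p:
  assumes "u \<in> U 1"
  shows "padic_pow nm ([p] \<cdot>\<^bsub>Zp p\<^esub> \<one>\<^bsub>Zp p\<^esub>) u = u ^ p"
proof (rule padic_pow_eqI[OF _ assms])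
  have p0: "p > 0" using p_gt_1 by simp
  interpret cring "Zp p" using p0 by (rule Zp_cring)
  show "[p] \<cdot>\<^bsub>Zp p\<^esub> \<one>\<^bsub>Zp p\<^esub> \<in> carrier (Zp p)" by simp
  show "congr n (u ^ nat (([p] \<cdot>\<^bsub>Zp p\<^esub> \<one>\<^bsub>Zp p\<^esub>) n)) (u ^ p)" for n
  proof -
    have "nat (int p mod int p ^ n) = p mod p ^ n"
      by (metis nat_int of_nat_mod of_nat_power)
    then show ?thesis
      using congr_power_mod[OF assms, of n p] by (simp add: Zp_of_nat[OF p0])
  qed
qed

text \<open>A multiple of \<open>\<pi> ^ Suc n\<close> is a single product with first factor \<open>\<pi>\<close>.\<close>

lemma ideal_pow_eq_P: "ideal_pow (int_ring nm) (max_ideal nm) n = P n"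
proof (induction n)
  case 0
  show ?case by (auto simp: int_ring_def P_0_iff)
next
  case (Suc n)
  have "x \<in> P (Suc n)" if "x \<in> ideal_prod (int_ring nm) (max_ideal nm) (P n)" for x
    using that
  proof induction
    case (prod i j)
    then show ?case
      using P_mult[of i "Suc 0" j n] by (simp add: int_ring_def max_ideal_def P_Suc_0_iff)
  next
    case (sum s1 s2)
    then show ?case by (simp add: int_ring_def P_add)
  qed
  moreover have "x \<in> ideal_prod (int_ring nm) (max_ideal nm) (P n)" if "x \<in> P (Suc n)" for x
  proof -
    have "\<pi> \<noteq> 0" using pi_pos by auto
    moreover have "x / \<pi> \<in> P n"
      using that pi_pos by (simp add: P_def nm_divide field_simps)
    moreover have "\<pi> \<in> max_ideal nm"
      using pi_less_1 by (simp add: max_ideal_def)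
    ultimately show ?thesis
      using ideal_prod.prod[of \<pi> "max_ideal nm" "x / \<pi>" "P n" "int_ring nm"]
      by (simp add: int_ring_def)
  qed
  ultimately show ?case using Suc by auto
qed

lemma unit_filt_eq_U: "unit_filt nm n = U n"
  unfolding unit_filt_def ideal_pow_eq_P
  by (auto simp: U_iff) (metis add_diff_cancel_left' diff_add_cancel add.commute)

lemma U_filtered_simps [simp]:
  "carrier (U_filtered nm) = U 1"
  "zero (U_filtered nm) = 1"
  "add (U_filtered nm) = (*)"
  "smult (U_filtered nm) = padic_pow nm"
  "filt (U_filtered nm) = U"
  by (simp_all add: U_filtered_def unit_filt_eq_U fun_eq_iff)

lemma congr_power_Zp_reduce:
  assumes "u \<in> U 1" "0 \<le> k"
  shows "congr n (u ^ nat (k mod int p ^ n)) (u ^ nat k)"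
proof -
  have "nat (k mod int p ^ n) = nat k mod p ^ n"
    using assms(2) by (simp add: nat_mod_distrib nat_power_eq)
  then show ?thesis using congr_power_mod[OF assms(1)] by simp
qed

lemma module_U: "Module.module (Zp p) (U_filtered nm)"
proof (rule moduleI, unfold U_filtered_simps)
  have p0: "p > 0" using p_gt_1 by simp
  interpret Z: cring "Zp p" using p0 by (rule Zp_cring)
  show "cring (Zp p)" by (rule Z.is_cring)
  show "abelian_group (U_filtered nm)"
  proof (rule abelian_groupI, unfold U_filtered_simps)
    show "\<exists>y\<in>U 1. y * x = 1" if "x \<in> U 1" for x
      using that U_divide[of 1 1 x] principal_unit_nonzero[of x] by (intro bexI[of _ "1 / x"]) auto
  qed (auto intro: U_mult)
  fix a b x y assume a: "a \<in> carrier (Zp p)" and x: "x \<in> U 1"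
  show ax: "padic_pow nm a x \<in> U 1"
    using a x by (intro padic_pow_in_U) auto
  {
    assume y: "y \<in> U 1"
    show "padic_pow nm a (x * y) = padic_pow nm a x * padic_pow nm a y"
    proof (rule padic_pow_eqI[OF a])
      show "congr n ((x * y) ^ nat (a n)) (padic_pow nm a x * padic_pow nm a y)" for n
        unfolding power_mult_distrib
        using a x y ax by (intro congr_units_mult padic_pow_congr) (auto intro: U_power)
    qed (use x y in \<open>auto intro: U_mult\<close>)
  }
  {
    assume b: "b \<in> carrier (Zp p)"
    note nonneg = Zp_nonneg[OF a] Zp_nonneg[OF b]
    have bx: "padic_pow nm b x \<in> U 1"
      using b x by (intro padic_pow_in_U) auto
    show "padic_pow nm (a \<oplus>\<^bsub>Zp p\<^esub> b) x = padic_pow nm a x * padic_pow nm b x"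
    proof (rule padic_pow_eqI)
      fix n
      have "congr n (x ^ nat ((a n + b n) mod int p ^ n)) (x ^ nat (a n + b n))"
        using x nonneg by (intro congr_power_Zp_reduce) auto
      also have "x ^ nat (a n + b n) = x ^ nat (a n) * x ^ nat (b n)"
        using nonneg by (simp add: nat_add_distrib power_add)
      also have "congr n \<dots> (padic_pow nm a x * padic_pow nm b x)"
        using a b x ax by (intro congr_units_mult padic_pow_congr) (auto intro: U_power)
      finally show "congr n (x ^ nat ((a \<oplus>\<^bsub>Zp p\<^esub> b) n)) (padic_pow nm a x * padic_pow nm b x)"
        by simp
    qed (use a b x in \<open>auto simp del: Zp_simps\<close>)
    show "padic_pow nm (a \<otimes>\<^bsub>Zp p\<^esub> b) x = padic_pow nm a (padic_pow nm b x)"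
    proof (rule padic_pow_eqI)
      fix n
      have "congr n (x ^ nat ((a n * b n) mod int p ^ n)) (x ^ nat (a n * b n))"
        using x nonneg by (intro congr_power_Zp_reduce) auto
      also have "x ^ nat (a n * b n) = (x ^ nat (b n)) ^ nat (a n)"
        using nonneg by (simp add: nat_mult_distrib mult.commute flip: power_mult)
      also have "congr n \<dots> (padic_pow nm b x ^ nat (a n))"
        using b x bx by (intro congr_units_power padic_pow_congr) (auto intro: U_power)
      also have "congr n \<dots> (padic_pow nm a (padic_pow nm b x))"
        using a bx by (rule padic_pow_congr)
      finally show "congr n (x ^ nat ((a \<otimes>\<^bsub>Zp p\<^esub> b) n)) (padic_pow nm a (padic_pow nm b x))"
        by simp
    qed (use a b x in \<open>auto simp del: Zp_simps\<close>)
  }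
next
  fix x assume x: "x \<in> U 1"
  have p0: "p > 0" using p_gt_1 by simp
  interpret Z: cring "Zp p" using p0 by (rule Zp_cring)
  show "padic_pow nm \<one>\<^bsub>Zp p\<^esub> x = x"
  proof (rule padic_pow_eqI)
    show "congr n (x ^ nat (\<one>\<^bsub>Zp p\<^esub> n)) x" for n
      using congr_power_Zp_reduce[OF x, of 1 n] by (simp add: Zp_simps)
  qed (use x in auto)
qed

lemma filtered_module_U: "filtered_module (Zp p) (U_filtered nm)"
proof (rule filtered_moduleI[OF module_U], unfold U_filtered_simps)
  fix x assume "\<And>i. 1 \<le> i \<Longrightarrow> x \<in> U i"
  then have "x - 1 \<in> P n" for n
    using P_mono[of n "Suc n" "x - 1"] by (simp add: U_iff)
  then show "x = 1" using P_separated[of "x - 1"] by simp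
qed (auto intro: U_mult padic_pow_in_U U_mono[rotated])

section \<open>Bases of the graded pieces\<close>

definition residue :: "'a \<Rightarrow> 'a set" where "residue x = {y. nm (x - y) < 1}"

lemma residue_eq_iff: "residue x = residue y \<longleftrightarrow> congr 1 x y"
proof -
  have lt: "nm (x - z) < 1" if "nm (x - y) < 1" "nm (y - z) < 1" for x y z
    using nm_add[of "x - y" "y - z"] that by simp
  have "nm (x - y) < 1" if "residue x = residue y"
  proof -
    have "y \<in> residue x" using that by (simp add: residue_def)
    then show ?thesis by (simp add: residue_def)
  qed
  moreover have "residue x = residue y" if "nm (x - y) < 1"
    using lt[OF that] lt[of y x] that nm_diff_commute[of x y] by (auto simp: residue_def)
  ultimately show ?thesis
    by (auto simp: congr_def P_Suc_0_iff)
qed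

lemma card_residues: "card (residue ` P 0) = p ^ f"
proof -
  have "residue = (\<lambda>x. {y. nm (x - y) < 1})" "P 0 = {x. nm x \<le> 1}"
    by (auto simp: residue_def fun_eq_iff P_0_iff)
  then show ?thesis using residue_card by simp
qed

lemma finite_residues: "finite (residue ` P 0)"
  using card_residues p_gt_1 by (metis card.infinite not_one_less_zero power_eq_0_iff)

lemma of_nat_in_P_0: "of_nat k \<in> P 0"
  by (simp add: P_0_iff nm_of_nat)

lemma p_in_P_1: "of_nat p \<in> P 1"
proof -
  have "enat 1 \<le> enat 0 + e"
    using e_nonzero by (cases e) (auto simp: zero_enat_def)
  then show ?thesis using p_mult_in_P[of 1 0 1] by simp
qed

lemma P_sum: "(\<And>i. i \<in> A \<Longrightarrow> g i \<in> P n) \<Longrightarrow> sum g A \<in> P n"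
  by (induction A rule: infinite_finite_induct) (simp_all add: P_add)

lemma congr_of_nat_mod: "congr 1 (of_nat (k mod p)) (of_nat k)"
proof -
  have "of_nat k - of_nat (k mod p) = (of_nat (k div p) * of_nat p :: 'a)"
    by (metis add_diff_cancel_right' div_mult_mod_eq of_nat_add of_nat_mult)
  then have "congr 1 (of_nat k) (of_nat (k mod p))"
    unfolding congr_def using P_mult_left[OF nm_of_nat p_in_P_1] by simp
  then show ?thesis by (rule congr_sym)
qed

text \<open>The prime field \<open>\<int>/p\<close> acts on the residue field.  Fewer than \<open>f\<close> vectors span fewer than \<open>p ^ f\<close>
  classes, so an independent family can be enlarged until it has \<open>f\<close> members.\<close>

lemma residue_basis:
  "\<exists>b. (\<forall>j<f. b j \<in> P 0) \<and>
    (\<forall>c::nat \<Rightarrow> nat. (\<Sum>j<f. of_nat (c j) * b j) \<in> P 1 \<longrightarrow> (\<forall>j<f. p dvd c j))"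
proof -
  have "\<exists>b. (\<forall>j<k. b j \<in> P 0) \<and>
    (\<forall>c::nat \<Rightarrow> nat. (\<Sum>j<k. of_nat (c j) * b j) \<in> P 1 \<longrightarrow> (\<forall>j<k. p dvd c j))" if "k \<le> f" for k
    using that
  proof (induction k)
    case (Suc k)
    then obtain b where b: "\<And>j. j < k \<Longrightarrow> b j \<in> P 0"
      and indep: "\<And>c::nat \<Rightarrow> nat. (\<Sum>j<k. of_nat (c j) * b j) \<in> P 1 \<Longrightarrow> (\<forall>j<k. p dvd c j)"
      by auto
    define C where "C = ({..<k} \<rightarrow>\<^sub>E {..<p})"
    define S where "S = (\<lambda>c. residue (\<Sum>j<k. of_nat (c j) * b j)) ` C"
    have "card S \<le> card C"
      unfolding S_def C_def by (intro card_image_le finite_PiE) auto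
    also have "\<dots> = p ^ k"
      unfolding C_def by (simp add: card_PiE)
    also have "\<dots> < p ^ f"
      using Suc.prems p_gt_1 by (intro power_strict_increasing) auto
    finally have "card S < card (residue ` P 0)"
      by (simp add: card_residues)
    moreover have "finite S"
      unfolding S_def C_def by (intro finite_imageI finite_PiE) auto
    ultimately have "\<not> residue ` P 0 \<subseteq> S"
      by (meson card_mono leD)
    then obtain z where z: "z \<in> P 0" "residue z \<notin> S" by blast
    have notin: "\<not> congr 1 z (\<Sum>j<k. of_nat (c j) * b j)" for c :: "nat \<Rightarrow> nat"
    proof
      assume "congr 1 z (\<Sum>j<k. of_nat (c j) * b j)"
      moreover have "congr 1 (\<Sum>j<k. of_nat (c j mod p) * b j) (\<Sum>j<k. of_nat (c j) * b j)"
        unfolding congr_def sum_subtractf[symmetric]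
      proof (rule P_sum)
        fix j assume "j \<in> {..<k}"
        then have "b j * (of_nat (c j mod p) - of_nat (c j)) \<in> P 1"
          using b[of j] congr_of_nat_mod by (intro P_mult_left) (auto simp: congr_def P_0_iff)
        then show "of_nat (c j mod p) * b j - of_nat (c j) * b j \<in> P 1"
          by (simp add: algebra_simps)
      qed
      ultimately have "congr 1 z (\<Sum>j<k. of_nat (c j mod p) * b j)"
        by (blast intro: congr_trans congr_sym)
      also have "(\<Sum>j<k. of_nat (c j mod p) * b j)
          = (\<Sum>j<k. of_nat ((\<lambda>j\<in>{..<k}. c j mod p) j) * b j)"
        by (intro sum.cong) auto
      finally have "residue z = residue (\<Sum>j<k. of_nat ((\<lambda>j\<in>{..<k}. c j mod p) j) * b j)"
        by (simp add: residue_eq_iff)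
      moreover have "(\<lambda>j\<in>{..<k}. c j mod p) \<in> C"
        unfolding C_def using p_gt_1 by auto
      ultimately show False using z(2) unfolding S_def by blast
    qed
    define b' where "b' = b(k := z)"
    have sum_b': "(\<Sum>j<Suc k. of_nat (c j) * b' j) = (\<Sum>j<k. of_nat (c j) * b j) + of_nat (c k) * z"
      for c :: "nat \<Rightarrow> nat"
      by (simp add: b'_def)
    have "p dvd c j" if c: "(\<Sum>j<Suc k. of_nat (c j) * b' j) \<in> P 1" and j: "j < Suc k"
      for c :: "nat \<Rightarrow> nat" and j
    proof -
      define s where "s = (\<Sum>j<k. of_nat (c j) * b j)"
      have s: "s + of_nat (c k) * z \<in> P 1"
        using c unfolding sum_b' s_def .
      have "p dvd c k"
      proof (rule ccontr)
        assume "\<not> p dvd c k"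
        then obtain d y where "c k * d = Suc (p * y)"
          using bezout_prime[OF prime_p] by blast
        then have d: "(d * c k) mod p = 1"
          using p_gt_1 by (simp add: mult.commute) (metis mod_Suc_eq mod_less mod_mult_self1_is_0 One_nat_def)
        \<comment> \<open>Multiplying the relation by the inverse \<open>d\<close> of \<open>c k\<close> expresses \<open>z\<close> through \<open>b\<close>; the factor
          \<open>p - 1\<close> stands for the sign, since coefficients are natural numbers.\<close>
        have "of_nat d * (s + of_nat (c k) * z) - z * (of_nat (d * c k) - of_nat ((d * c k) mod p))
            - of_nat p * (of_nat d * s) \<in> P 1"
        proof (intro P_diff)
          show "of_nat d * (s + of_nat (c k) * z) \<in> P 1"
            by (rule P_mult_left[OF nm_of_nat s])
          show "z * (of_nat (d * c k) - of_nat ((d * c k) mod p)) \<in> P 1"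
            using congr_sym[OF congr_of_nat_mod[of "d * c k"]] z(1)
            by (intro P_mult_left) (simp_all add: congr_def P_0_iff)
          have "s \<in> P 0"
            unfolding s_def using b P_mult[OF of_nat_in_P_0, of _ 0] by (intro P_sum) auto
          then show "of_nat p * (of_nat d * s) \<in> P 1"
            using P_mult[OF p_in_P_1, of "of_nat d * s" 0] P_mult[OF of_nat_in_P_0, of s 0 d] by simp
        qed
        also have "of_nat d * (s + of_nat (c k) * z) - z * (of_nat (d * c k) - of_nat ((d * c k) mod p))
            - of_nat p * (of_nat d * s) = z - of_nat (p - 1) * of_nat d * s"
          unfolding d using p_gt_1 by (simp add: of_nat_diff algebra_simps)
        also have "of_nat (p - 1) * of_nat d * s = (\<Sum>j<k. of_nat ((p - 1) * d * c j) * b j)"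
          by (simp only: s_def sum_distrib_left of_nat_mult mult.assoc)
        finally show False using notin[of "\<lambda>j. (p - 1) * d * c j"] by (simp add: congr_def)
      qed
      then obtain q where "c k = p * q" by blast
      then have "of_nat (c k) * z = (of_nat q * z) * of_nat p"
        by simp
      moreover have "of_nat q * z \<in> P 0"
        using P_mult[OF of_nat_in_P_0 z(1)] by simp
      ultimately have "of_nat (c k) * z \<in> P 1"
        using P_mult_left[OF _ p_in_P_1] by (simp only: P_0_iff)
      then have "s \<in> P 1"
        using P_diff[OF s, of "of_nat (c k) * z"] by simp
      then show ?thesis
        using indep[of c] \<open>p dvd c k\<close> j by (auto simp: s_def less_Suc_eq)
    qed
    moreover have "b' j \<in> P 0" if "j < Suc k" for j
      using b z(1) that by (auto simp: b'_def less_Suc_eq)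
    ultimately show ?case by blast
  qed simp
  then show ?thesis by blast
qed

text \<open>Independence over \<open>\<int>/p\<close> of the classes of \<open>w j\<close> in \<open>U n\<close> modulo \<open>U (Suc n)\<close>, written
  multiplicatively.\<close>

definition graded_independent :: "nat \<Rightarrow> (nat \<Rightarrow> 'a) \<Rightarrow> bool" where
  "graded_independent n w \<longleftrightarrow> (\<forall>j<f. w j \<in> U n) \<and>
     (\<forall>c::nat \<Rightarrow> nat. (\<Prod>j<f. w j ^ c j) \<in> U (Suc n) \<longrightarrow> (\<forall>j<f. p dvd c j))"

lemma graded_independentD:
  "\<lbrakk>graded_independent n w; (\<Prod>j<f. w j ^ c j) \<in> U (Suc n); j < f\<rbrakk> \<Longrightarrow> p dvd c j"
  by (simp add: graded_independent_def)

text \<open>On \<open>U n\<close> modulo \<open>U (Suc n)\<close>, multiplication of units becomes addition of the parts \<open>x - 1\<close>, because the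
  cross term lies in \<open>P (2 * n)\<close>.\<close>

lemma congr_mult_linear:
  assumes "1 \<le> n" "congr (Suc n) x (1 + a)" "congr (Suc n) y (1 + b)" "a \<in> P n" "b \<in> P n"
  shows "congr (Suc n) (x * y) (1 + (a + b))"
proof -
  have le: "nm z \<le> 1" if "z \<in> P n" for z
    using P_mono[of 0 n z] that by (simp add: P_0_iff)
  have "y \<in> P 0"
    using P_add[OF P_mono[of 0 "Suc n" "y - (1 + b)"] P_add[OF one_in_P_0 P_mono[of 0 n b]]] assms
    by (simp add: congr_def)
  then have "congr (Suc n) (x * y) ((1 + a) * (1 + b))"
    using assms le[of a] nm_add[of 1 a] by (intro congr_mult) (auto simp: P_0_iff)
  moreover have "a * b \<in> P (Suc n)"
    using P_mono[OF _ P_mult[OF assms(4,5)], of "Suc n"] assms(1) by simp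
  then have "congr (Suc n) ((1 + a) * (1 + b)) (1 + (a + b))"
    by (simp add: congr_def algebra_simps)
  ultimately show ?thesis by (rule congr_trans)
qed

lemma congr_power_linear:
  assumes "1 \<le> n" "a \<in> P n"
  shows "congr (Suc n) ((1 + a) ^ k) (1 + of_nat k * a)"
proof (induction k)
  case (Suc k)
  have "congr (Suc n) ((1 + a) * (1 + a) ^ k) (1 + (a + of_nat k * a))"
    using assms by (intro congr_mult_linear Suc P_mult_left nm_of_nat) auto
  then show ?case by (simp add: algebra_simps)
qed simp

lemma congr_prod_linear:
  assumes "1 \<le> n" "\<And>i. i \<in> A \<Longrightarrow> congr (Suc n) (g i) (1 + h i)" "\<And>i. i \<in> A \<Longrightarrow> h i \<in> P n"
  shows "congr (Suc n) (prod g A) (1 + sum h A)"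
  using assms
  by (induction A rule: infinite_finite_induct) (auto intro!: congr_mult_linear P_sum)

text \<open>The family \<open>1 + \<pi> ^ n * b j\<close> inherits independence from a basis \<open>b\<close> of the residue field.\<close>

lemma graded_independent_exists:
  assumes n: "1 \<le> n"
  shows "\<exists>w. graded_independent n w"
proof -
  obtain b where b: "\<And>j. j < f \<Longrightarrow> b j \<in> P 0"
    and indep: "\<And>c::nat \<Rightarrow> nat. (\<Sum>j<f. of_nat (c j) * b j) \<in> P 1 \<Longrightarrow> (\<forall>j<f. p dvd c j)"
    using residue_basis by auto
  define w where "w j = 1 + \<pi> ^ n * b j" for j
  have pb: "\<pi> ^ n * b j \<in> P n" if "j < f" for j
    using P_mult[OF pi_power_in_P b[OF that], of n] by simp
  have "\<forall>j<f. p dvd c j" if c: "(\<Prod>j<f. w j ^ c j) \<in> U (Suc n)" for c :: "nat \<Rightarrow> nat"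
  proof -
    have "congr (Suc n) (\<Prod>j<f. w j ^ c j) (1 + (\<Sum>j<f. of_nat (c j) * (\<pi> ^ n * b j)))"
      unfolding w_def using n pb P_mult_left[OF nm_of_nat pb]
      by (intro congr_prod_linear congr_power_linear) auto
    then have "congr (Suc n) (1 + (\<Sum>j<f. of_nat (c j) * (\<pi> ^ n * b j))) 1"
      using c unfolding U_def by (blast intro: congr_trans congr_sym)
    moreover have "(\<Sum>j<f. of_nat (c j) * (\<pi> ^ n * b j)) = \<pi> ^ n * (\<Sum>j<f. of_nat (c j) * b j)"
      by (simp add: sum_distrib_left mult_ac)
    ultimately have "\<pi> ^ n * (\<Sum>j<f. of_nat (c j) * b j) \<in> P (Suc n)"
      by (simp add: congr_def)
    then have "(\<Sum>j<f. of_nat (c j) * b j) \<in> P 1"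
      using pi_pos by (simp add: P_def nm_mult nm_power)
    then show ?thesis by (rule indep)
  qed
  then have "graded_independent n w"
    using pb by (simp add: graded_independent_def w_def U_iff)
  then show ?thesis by blast
qed

text \<open>A relation between the \<open>p\<close>-th powers is the \<open>p\<close>-th power of a relation, so it descends to level \<open>n\<close>.\<close>

lemma graded_independent_power:
  assumes mu: "mu p = {1::'a}" and n: "1 \<le> n" and w: "graded_independent n w"
  shows "graded_independent (\<rho> n) (\<lambda>j. w j ^ p)"
  unfolding graded_independent_def
proof (intro conjI allI impI)
  show "w j ^ p \<in> U (\<rho> n)" if "j < f" for j
    using w n that by (intro U_p_power) (auto simp: graded_independent_def)
  fix c :: "nat \<Rightarrow> nat" and j
  assume c: "(\<Prod>j<f. (w j ^ p) ^ c j) \<in> U (Suc (\<rho> n))" and j: "j < f"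
  have "(\<Prod>j<f. (w j ^ p) ^ c j) = (\<Prod>j<f. w j ^ c j) ^ p"
    by (simp add: prod_power_distrib mult.commute flip: power_mult)
  moreover have "(\<Prod>j<f. w j ^ c j) \<in> U n"
    using w n by (intro U_prod U_power) (auto simp: graded_independent_def)
  ultimately have "(\<Prod>j<f. w j ^ c j) \<in> U (Suc n)"
    using p_power_reflects_level[OF mu n] c by simp
  then show "p dvd c j"
    by (rule graded_independentD[OF w _ j])
qed

lemma graded_independent_power_iterate:
  assumes mu: "mu p = {1::'a}" and n: "1 \<le> n" and w: "graded_independent n w"
  shows "graded_independent ((\<rho> ^^ k) n) (\<lambda>j. w j ^ (p ^ k))"
proof (induction k)
  case (Suc k)
  have "1 \<le> (\<rho> ^^ k) n"
    using shift_funpow_ge[OF shift_\<rho> n, of k] n by simp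
  then have "graded_independent (\<rho> ((\<rho> ^^ k) n)) (\<lambda>j. (w j ^ (p ^ k)) ^ p)"
    using Suc by (intro graded_independent_power[OF mu])
  then show ?case by (simp add: mult.commute flip: power_mult)
qed (simp add: w)

text \<open>The quotient of \<open>U n\<close> by \<open>U (Suc n)\<close> has at most \<open>p ^ f\<close> elements, and an independent family of
  \<open>f\<close> elements already produces that many products.\<close>

lemma graded_independent_spans:
  assumes n: "1 \<le> n" and w: "graded_independent n w" and t: "t \<in> U n"
  shows "\<exists>c. (\<forall>j<f. c j < p) \<and> congr (Suc n) (\<Prod>j<f. w j ^ c j) t"
proof -
  define C where "C = ({..<f} \<rightarrow>\<^sub>E {..<p})"
  define g where "g c = (\<Prod>j<f. w j ^ c j)" for c :: "nat \<Rightarrow> nat"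
  define r where "r x = residue ((x - 1) / \<pi> ^ n)" for x
  have pi0: "\<pi> \<noteq> 0" using pi_pos by auto
  have r_eq: "r x = r y \<longleftrightarrow> congr (Suc n) x y" for x y
  proof -
    have "(x - 1) / \<pi> ^ n - (y - 1) / \<pi> ^ n = (x - y) / \<pi> ^ n"
      by (simp flip: diff_divide_distrib)
    then show ?thesis
      using pi_pos by (simp add: r_def residue_eq_iff congr_def P_def nm_divide nm_power field_simps)
  qed
  have r_in: "r x \<in> residue ` P 0" if "x \<in> U n" for x
    using that pi_pos by (auto simp: r_def U_iff P_def nm_divide nm_power field_simps)
  have w_U: "w j \<in> U n" if "j < f" for j
    using w that by (simp add: graded_independent_def)
  have g_U: "g c \<in> U n" for c
    unfolding g_def using w_U n by (intro U_prod U_power) auto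
  have "inj_on (\<lambda>c. r (g c)) C"
  proof (rule inj_onI)
    fix c d assume cd: "c \<in> C" "d \<in> C" "r (g c) = r (g d)"
    then have congr: "congr (Suc n) (g c) (g d)" by (simp add: r_eq)
    have one: "g c \<in> U (Suc 0)" "g d \<in> U (Suc 0)"
      using U_principal[OF n g_U] by auto
    \<comment> \<open>\<open>g c / g d\<close> with the inverse of \<open>g d\<close> replaced by \<open>g d ^ (p - 1)\<close>, which keeps exponents in \<open>\<nat>\<close>.\<close>
    have "(\<Prod>j<f. w j ^ ((p - 1) * d j)) = g d ^ (p - 1)"
      unfolding g_def prod_power_distrib by (simp add: mult.commute flip: power_mult)
    then have "(\<Prod>j<f. w j ^ (c j + (p - 1) * d j)) = g c * g d ^ (p - 1)"
      by (simp only: g_def power_add prod.distrib)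
    also have "congr (Suc n) \<dots> (g d * g d ^ (p - 1))"
      using congr one by (intro congr_units_mult) (auto intro: U_power)
    also have "g d * g d ^ (p - 1) = g d ^ p"
      using p_gt_1 by (simp flip: power_Suc)
    finally have "(\<Prod>j<f. w j ^ (c j + (p - 1) * d j)) \<in> U (Suc n)"
    proof (rule congr_in_U)
      show "g d ^ p \<in> U (Suc n)"
        using U_p_power[OF n g_U] shift_greater[OF shift_\<rho> n] U_mono[of "Suc n" "\<rho> n"] by simp
    qed
    then have dvd: "p dvd c j + (p - 1) * d j" if "j < f" for j
      using graded_independentD[OF w, of "\<lambda>j. c j + (p - 1) * d j"] that by simp
    have "c j = d j" if "j \<in> {..<f}" for j
    proof -
      have "c j < p" "d j < p"
        using cd that by (auto simp: C_def)
      have "c j + (p - 1) * d j + d j = c j + p * d j"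
        using p_gt_1 by (cases p) auto
      then have "(c j + p * d j) mod p = d j mod p"
        using dvd[of j] that by (metis dvd_imp_mod_0 lessThan_iff mod_add_left_eq add_0)
      then show ?thesis using \<open>c j < p\<close> \<open>d j < p\<close> by simp
    qed
    then show "c = d"
      using cd unfolding C_def by (blast intro: PiE_ext)
  qed
  then have "card ((\<lambda>c. r (g c)) ` C) = card (residue ` P 0)"
    by (simp add: card_image card_residues C_def card_PiE)
  moreover have "(\<lambda>c. r (g c)) ` C \<subseteq> residue ` P 0"
    using r_in g_U by auto
  ultimately have "(\<lambda>c. r (g c)) ` C = residue ` P 0"
    using finite_residues by (intro card_subset_eq) auto
  then have "r t \<in> (\<lambda>c. r (g c)) ` C"
    using r_in[OF t] by simp
  then obtain c where c: "c \<in> C" "r t = r (g c)"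
    by blast
  then have "congr (Suc n) (\<Prod>j<f. w j ^ c j) t"
    using r_eq g_def by metis
  moreover have "c j < p" if "j < f" for j
    using c(1) that by (auto simp: C_def)
  ultimately show ?thesis by blast
qed

text \<open>Starting from bases at the levels outside the image of \<open>\<rho>\<close>, iterated \<open>p\<close>-th powers give bases at
  all levels.\<close>

lemma compatible_bases_exist:
  assumes mu: "mu p = {1::'a}"
  shows "\<exists>w. (\<forall>n\<ge>1. graded_independent n (w n)) \<and>
    (\<forall>i\<in>shift_compl \<rho>. \<forall>k j. w ((\<rho> ^^ k) i) j = w i j ^ (p ^ k))"
proof -
  define h where "h = (\<lambda>(i, k). (\<rho> ^^ k) i)"
  define T where "T = shift_compl \<rho> \<times> (UNIV :: nat set)"
  have bij: "bij_betw h T {1..}"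
    unfolding h_def T_def by (rule shift_orbits[OF shift_\<rho>])
  obtain u where u: "\<And>n. 1 \<le> n \<Longrightarrow> graded_independent n (u n)"
    using graded_independent_exists by metis
  define w where "w n j = (case inv_into T h n of (i, k) \<Rightarrow> u i j ^ (p ^ k))" for n j
  have w: "w ((\<rho> ^^ k) i) j = u i j ^ (p ^ k)" if "i \<in> shift_compl \<rho>" for i k j
    using bij_betw_inv_into_left[OF bij, of "(i, k)"] that by (simp add: w_def h_def T_def)
  have "graded_independent n (w n)" if "1 \<le> n" for n
  proof -
    have "n \<in> h ` T"
      using bij that by (simp add: bij_betw_def)
    then obtain i k where ik: "i \<in> shift_compl \<rho>" "n = (\<rho> ^^ k) i"
      by (auto simp: h_def T_def)
    then have "graded_independent n (\<lambda>j. u i j ^ (p ^ k))"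
      using graded_independent_power_iterate[OF mu, of i "u i" k] u[of i] by (simp add: shift_compl_def)
    moreover have "w n = (\<lambda>j. u i j ^ (p ^ k))"
      using w[OF ik(1)] by (simp add: ik(2) fun_eq_iff)
    ultimately show ?thesis
      using ik(2) by simp
  qed
  moreover have "w ((\<rho> ^^ k) i) j = w i j ^ (p ^ k)" if "i \<in> shift_compl \<rho>" for i k j
    using w[OF that, of k] w[OF that, of 0] by simp
  ultimately show ?thesis by blast
qed

end

section \<open>Expansions of principal units\<close>

locale compatible_bases = uniformized_field +
  fixes w :: "nat \<Rightarrow> nat \<Rightarrow> 'a"
  assumes basis: "1 \<le> n \<Longrightarrow> graded_independent n (w n)"
    and basis_power: "i \<in> shift_compl \<rho> \<Longrightarrow> w ((\<rho> ^^ k) i) j = w i j ^ (p ^ k)"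
begin

abbreviation T :: "nat set" where "T \<equiv> shift_compl \<rho>"

abbreviation M :: "(nat \<Rightarrow> int, nat \<Rightarrow> nat \<Rightarrow> nat \<Rightarrow> int) filtered_module" where
  "M \<equiv> M_shift_pow p \<rho> f"

lemma p_pos: "p > 0"
  using p_gt_1 by simp

lemma T_ge_1: "i \<in> T \<Longrightarrow> 1 \<le> i"
  by (simp add: shift_compl_def)

lemma level_ge_1: "i \<in> T \<Longrightarrow> 1 \<le> (\<rho> ^^ k) i"
  using shift_funpow_ge[OF shift_\<rho> T_ge_1, of i k] T_ge_1[of i] by simp

lemma w_in_U: "1 \<le> n \<Longrightarrow> j < f \<Longrightarrow> w n j \<in> U n"
  using basis by (simp add: graded_independent_def)

lemma w_in_U_1: "1 \<le> n \<Longrightarrow> j < f \<Longrightarrow> w n j \<in> U 1"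
  using w_in_U U_principal by simp

lemma M_component: "\<lbrakk>x \<in> carrier M; j < f; i \<in> T\<rbrakk> \<Longrightarrow> x j i \<in> carrier (Zp p)"
  by (simp add: M_shift_pow_eq PiE_iff)

text \<open>The digit of \<open>x j i\<close> at position \<open>k\<close> governs the level \<open>(\<rho> ^^ k) i\<close>, and each level
  receives exactly one digit for each \<open>j\<close>.\<close>

definition level_digit :: "(nat \<Rightarrow> nat \<Rightarrow> nat \<Rightarrow> int) \<Rightarrow> nat \<Rightarrow> nat \<Rightarrow> nat" where
  "level_digit x n j =
    (case inv_into (T \<times> UNIV) (\<lambda>(i, k). (\<rho> ^^ k) i) n of (i, k) \<Rightarrow> Zp_digit p (x j i) k)"

lemma level_digit_eq:
  assumes "i \<in> T"
  shows "level_digit x ((\<rho> ^^ k) i) j = Zp_digit p (x j i) k"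
  using bij_betw_inv_into_left[OF shift_orbits[OF shift_\<rho>], of "(i, k)"] assms
  by (simp add: level_digit_def)

lemma level_cases:
  assumes "1 \<le> n"
  obtains i k where "i \<in> T" "n = (\<rho> ^^ k) i"
proof -
  have "n \<in> (\<lambda>(i, k). (\<rho> ^^ k) i) ` (T \<times> UNIV)"
    using shift_orbits[OF shift_\<rho>] assms by (simp add: bij_betw_def)
  then show ?thesis using that by auto
qed

lemma level_digit_less:
  assumes "x \<in> carrier M" "1 \<le> n" "j < f"
  shows "level_digit x n j < p"
  using level_cases[OF assms(2)] level_digit_eq Zp_digit_less[OF p_pos M_component] assms(1,3) by metis

text \<open>The same element of \<open>U 1\<close> is approximated in two ways: modulo \<open>P N\<close>, \<open>module_approx\<close> is visibly a
  homomorphism in \<open>x\<close>, whereas \<open>digit_approx\<close> makes the filtration visible.\<close>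

definition module_approx :: "nat \<Rightarrow> (nat \<Rightarrow> nat \<Rightarrow> nat \<Rightarrow> int) \<Rightarrow> 'a" where
  "module_approx N x = (\<Prod>j<f. \<Prod>i\<in>T \<inter> {..<N}. w i j ^ nat (x j i N))"

definition digit_approx :: "nat \<Rightarrow> (nat \<Rightarrow> nat \<Rightarrow> nat) \<Rightarrow> 'a" where
  "digit_approx N D = (\<Prod>n\<in>{1..<N}. \<Prod>j<f. w n j ^ D n j)"

lemma digit_factor_in_U: "1 \<le> n \<Longrightarrow> (\<Prod>j<f. w n j ^ D j) \<in> U n"
  by (intro U_prod U_power w_in_U) auto

lemma digit_approx_0 [simp]: "digit_approx 0 D = 1"
  by (simp add: digit_approx_def)

lemma digit_approx_Suc:
  "digit_approx (Suc N) D = digit_approx N D * (if N = 0 then 1 else \<Prod>j<f. w N j ^ D N j)"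
  by (simp add: digit_approx_def)

lemma digit_approx_in_U: "digit_approx N D \<in> U 1"
  unfolding digit_approx_def by (rule U_prod) (auto intro: U_principal[OF _ digit_factor_in_U])

lemma module_approx_in_U: "module_approx N x \<in> U 1"
  unfolding module_approx_def using T_ge_1 by (intro U_prod U_power w_in_U_1) auto

lemma digit_approx_step: "congr N (digit_approx (Suc N) D) (digit_approx N D)"
  using digit_approx_in_U digit_factor_in_U[of N "D N"]
  by (auto simp: digit_approx_Suc intro: congr_absorb_right)

text \<open>Expanding each exponent in its digits gives one factor for every pair \<open>(i, k)\<close> with \<open>i, k < N\<close>.  These
  pairs cover all levels below \<open>N\<close>, and the remaining factors lie in \<open>U N\<close>.\<close>

lemma module_approx_congr_digit_approx:
  assumes x: "x \<in> carrier M"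
  shows "congr N (module_approx N x) (digit_approx N (level_digit x))"
proof (cases "N = 0")
  case True
  then show ?thesis by (simp add: module_approx_def)
next
  case False
  define D where "D = level_digit x"
  define h where "h = (\<lambda>(i, k). (\<rho> ^^ k) i)"
  define B where "B = (T \<inter> {..<N}) \<times> {..<N}"
  have bij: "bij_betw h (T \<times> UNIV) {1..}"
    unfolding h_def by (rule shift_orbits[OF shift_\<rho>])
  have inj: "inj_on h B"
    using bij by (rule inj_on_subset[OF bij_betw_imp_inj_on]) (auto simp: B_def)
  have hB: "h ` B \<subseteq> {1..}"
    using bij by (auto simp: bij_betw_def B_def)
  have finite: "finite (h ` B)" by (simp add: B_def)
  have levels: "{1..<N} \<subseteq> h ` B"
  proof
    fix n assume n: "n \<in> {1..<N}"
    then obtain i k where ik: "i \<in> T" "n = (\<rho> ^^ k) i"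
      using level_cases[of n] by auto
    then have "i + k \<le> n"
      using shift_funpow_ge[OF shift_\<rho> T_ge_1] by simp
    then have "(i, k) \<in> B" using n ik(1) by (simp add: B_def)
    then show "n \<in> h ` B" using ik(2) by (force simp: h_def)
  qed
  have row: "congr N (\<Prod>i\<in>T \<inter> {..<N}. w i j ^ nat (x j i N)) (\<Prod>n\<in>{1..<N}. w n j ^ D n j)"
    if j: "j < f" for j
  proof -
    have "(\<Prod>i\<in>T \<inter> {..<N}. w i j ^ nat (x j i N))
        = (\<Prod>i\<in>T \<inter> {..<N}. \<Prod>k<N. w (h (i, k)) j ^ D (h (i, k)) j)"
    proof (rule prod.cong)
      fix i assume "i \<in> T \<inter> {..<N}"
      then have i: "i \<in> T" by simp
      have "w i j ^ nat (x j i N) = (\<Prod>k<N. w i j ^ (Zp_digit p (x j i) k * p ^ k))"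
        unfolding Zp_digit_expansion[OF M_component[OF x j i]] by (rule power_sum)
      also have "\<dots> = (\<Prod>k<N. w (h (i, k)) j ^ D (h (i, k)) j)"
        using i by (simp add: h_def D_def basis_power level_digit_eq mult.commute flip: power_mult)
      finally show "w i j ^ nat (x j i N) = (\<Prod>k<N. w (h (i, k)) j ^ D (h (i, k)) j)" .
    qed simp
    also have "\<dots> = (\<Prod>b\<in>B. w (h b) j ^ D (h b) j)"
      by (simp add: B_def prod.cartesian_product)
    also have "\<dots> = (\<Prod>n\<in>h ` B. w n j ^ D n j)"
      using inj by (simp add: prod.reindex)
    also have "\<dots> = (\<Prod>n\<in>h ` B - {1..<N}. w n j ^ D n j) * (\<Prod>n\<in>{1..<N}. w n j ^ D n j)"
      using levels finite by (rule prod.subset_diff)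
    also have "congr N \<dots> (\<Prod>n\<in>{1..<N}. w n j ^ D n j)"
      unfolding mult.commute[of "prod _ (_ - _)"]
    proof (rule congr_absorb_right)
      show "(\<Prod>n\<in>{1..<N}. w n j ^ D n j) \<in> U (Suc 0)"
        using w_in_U_1 j by (intro U_prod U_power) auto
      show "(\<Prod>n\<in>h ` B - {1..<N}. w n j ^ D n j) \<in> U N"
      proof (intro U_prod U_power)
        fix n assume n: "n \<in> h ` B - {1..<N}"
        then have "1 \<le> n" "N \<le> n" using hB by auto
        then show "w n j \<in> U N" using w_in_U[of n j] U_mono[of N n] j by simp
      qed (use False in auto)
    qed (use False in simp)
    finally show ?thesis .
  qed
  have "congr N (module_approx N x) (\<Prod>j<f. \<Prod>n\<in>{1..<N}. w n j ^ D n j)"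
    unfolding module_approx_def
  proof (rule congr_units_prod)
    fix j assume "j \<in> {..<f}"
    then have j: "j < f" by simp
    show "(\<Prod>i\<in>T \<inter> {..<N}. w i j ^ nat (x j i N)) \<in> U (Suc 0)"
      using w_in_U_1 T_ge_1 j by (intro U_prod U_power) auto
    show "(\<Prod>n\<in>{1..<N}. w n j ^ D n j) \<in> U (Suc 0)"
      using w_in_U_1 j by (intro U_prod U_power) auto
    show "congr N (\<Prod>i\<in>T \<inter> {..<N}. w i j ^ nat (x j i N)) (\<Prod>n\<in>{1..<N}. w n j ^ D n j)"
      by (rule row[OF j])
  qed
  also have "(\<Prod>j<f. \<Prod>n\<in>{1..<N}. w n j ^ D n j) = digit_approx N D"
    unfolding digit_approx_def by (rule prod.swap)
  finally show ?thesis by (simp add: D_def)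
qed

definition unit_of :: "(nat \<Rightarrow> nat \<Rightarrow> nat \<Rightarrow> int) \<Rightarrow> 'a" where
  "unit_of x = (SOME y. \<forall>N. congr N (digit_approx N (level_digit x)) y)"

lemma unit_of_congr_digit: "congr N (digit_approx N (level_digit x)) (unit_of x)"
proof -
  have "\<exists>y. \<forall>N. digit_approx N (level_digit x) - y \<in> P N"
  proof (rule P_complete)
    show "digit_approx (Suc k) (level_digit x) - digit_approx k (level_digit x) \<in> P k" for k
      using digit_approx_step by (simp add: congr_def)
  qed simp
  then have "\<forall>N. congr N (digit_approx N (level_digit x)) (unit_of x)"
    unfolding unit_of_def congr_def by (rule someI_ex)
  then show ?thesis by blast
qed

lemma unit_of_congr_module:
  "x \<in> carrier M \<Longrightarrow> congr N (module_approx N x) (unit_of x)"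
  by (rule congr_trans[OF module_approx_congr_digit_approx unit_of_congr_digit])

lemma unit_of_eqI:
  assumes "x \<in> carrier M" "\<And>N. congr N (module_approx N x) y"
  shows "unit_of x = y"
  using P_limit_unique[of "\<lambda>N. module_approx N x"] unit_of_congr_module[OF assms(1)] assms(2)
  unfolding congr_def by blast

lemma unit_of_in_U_1: "unit_of x \<in> U 1"
  using congr_in_U[OF congr_sym[OF unit_of_congr_digit[of 1 x]]] digit_approx_in_U by blast

lemma unit_of_add:
  assumes x: "x \<in> carrier M" and y: "y \<in> carrier M"
  shows "unit_of (x \<oplus>\<^bsub>M\<^esub> y) = unit_of x * unit_of y"
proof (rule unit_of_eqI)
  interpret M: filtered_module "Zp p" M
    by (rule filtered_module_M_shift_pow[OF shift_\<rho> p_pos])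
  show "x \<oplus>\<^bsub>M\<^esub> y \<in> carrier M" using x y by (rule M.M.a_closed)
  fix N
  have "congr N (module_approx N (x \<oplus>\<^bsub>M\<^esub> y))
      (\<Prod>j<f. \<Prod>i\<in>T \<inter> {..<N}. w i j ^ nat (x j i N) * w i j ^ nat (y j i N))"
    unfolding module_approx_def
  proof (intro congr_units_prod)
    fix i j assume ij: "j \<in> {..<f}" "i \<in> T \<inter> {..<N}"
    then have ij': "j < f" "i \<in> T" by auto
    have wij: "w i j \<in> U 1" using w_in_U_1 T_ge_1 ij' by blast
    have nonneg: "0 \<le> x j i N" "0 \<le> y j i N"
      using Zp_nonneg M_component x y ij' by blast+
    have eq: "(x \<oplus>\<^bsub>M\<^esub> y) j i N = (x j i N + y j i N) mod int p ^ N"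
      using ij' by (simp add: M_shift_pow_eq)
    have "congr N (w i j ^ nat ((x \<oplus>\<^bsub>M\<^esub> y) j i N)) (w i j ^ nat (x j i N + y j i N))"
      unfolding eq using wij nonneg by (intro congr_power_Zp_reduce) auto
    then show "congr N (w i j ^ nat ((x \<oplus>\<^bsub>M\<^esub> y) j i N)) (w i j ^ nat (x j i N) * w i j ^ nat (y j i N))"
      using nonneg by (simp add: nat_add_distrib power_add)
    show "w i j ^ nat (x j i N) * w i j ^ nat (y j i N) \<in> U (Suc 0)"
      using wij by (intro U_mult U_power) auto
  qed (use T_ge_1 w_in_U_1 in \<open>auto intro!: U_prod U_mult U_power\<close>)
  also have "(\<Prod>j<f. \<Prod>i\<in>T \<inter> {..<N}. w i j ^ nat (x j i N) * w i j ^ nat (y j i N))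
      = module_approx N x * module_approx N y"
    by (simp add: module_approx_def prod.distrib)
  also have "congr N \<dots> (unit_of x * unit_of y)"
    using unit_of_congr_module x y unit_of_in_U_1 module_approx_in_U
    by (intro congr_units_mult) auto
  finally show "congr N (module_approx N (x \<oplus>\<^bsub>M\<^esub> y)) (unit_of x * unit_of y)" .
qed

lemma unit_of_smult:
  assumes a: "a \<in> carrier (Zp p)" and x: "x \<in> carrier M"
  shows "unit_of (a \<odot>\<^bsub>M\<^esub> x) = padic_pow nm a (unit_of x)"
proof (rule unit_of_eqI)
  interpret M: filtered_module "Zp p" M
    by (rule filtered_module_M_shift_pow[OF shift_\<rho> p_pos])
  show "a \<odot>\<^bsub>M\<^esub> x \<in> carrier M" using a x by (rule M.smult_closed)
  fix N
  have "congr N (module_approx N (a \<odot>\<^bsub>M\<^esub> x))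
      (\<Prod>j<f. \<Prod>i\<in>T \<inter> {..<N}. (w i j ^ nat (x j i N)) ^ nat (a N))"
    unfolding module_approx_def
  proof (intro congr_units_prod)
    fix i j assume ij: "j \<in> {..<f}" "i \<in> T \<inter> {..<N}"
    then have ij': "j < f" "i \<in> T" by auto
    have wij: "w i j \<in> U 1" using w_in_U_1 T_ge_1 ij' by blast
    have nonneg: "0 \<le> x j i N" "0 \<le> a N"
      using Zp_nonneg M_component x a ij' by blast+
    have eq: "(a \<odot>\<^bsub>M\<^esub> x) j i N = (a N * x j i N) mod int p ^ N"
      using ij' by (simp add: M_shift_pow_eq)
    have "congr N (w i j ^ nat ((a \<odot>\<^bsub>M\<^esub> x) j i N)) (w i j ^ nat (a N * x j i N))"
      unfolding eq using wij nonneg by (intro congr_power_Zp_reduce) auto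
    then show "congr N (w i j ^ nat ((a \<odot>\<^bsub>M\<^esub> x) j i N)) ((w i j ^ nat (x j i N)) ^ nat (a N))"
      using nonneg by (simp add: nat_mult_distrib mult.commute flip: power_mult)
    show "(w i j ^ nat (x j i N)) ^ nat (a N) \<in> U (Suc 0)"
      using wij by (intro U_power) auto
  qed (use T_ge_1 w_in_U_1 in \<open>auto intro!: U_prod U_power\<close>)
  also have "(\<Prod>j<f. \<Prod>i\<in>T \<inter> {..<N}. (w i j ^ nat (x j i N)) ^ nat (a N))
      = module_approx N x ^ nat (a N)"
    by (simp add: module_approx_def prod_power_distrib)
  also have "congr N \<dots> (unit_of x ^ nat (a N))"
    using unit_of_congr_module[OF x] unit_of_in_U_1 module_approx_in_U
    by (intro congr_units_power) auto
  also have "congr N \<dots> (padic_pow nm a (unit_of x))"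
    by (rule padic_pow_congr[OF a unit_of_in_U_1])
  finally show "congr N (module_approx N (a \<odot>\<^bsub>M\<^esub> x)) (padic_pow nm a (unit_of x))" .
qed

text \<open>If the digits below level \<open>m\<close> vanish, then \<open>unit_of x\<close> lies in \<open>U m\<close> and its class in the
  graded piece is given by the digits at level \<open>m\<close>, which are determined by independence.\<close>

lemma unit_of_in_U_iff:
  assumes x: "x \<in> carrier M" and n: "1 \<le> n"
  shows "unit_of x \<in> U n \<longleftrightarrow> (\<forall>m. 1 \<le> m \<and> m < n \<longrightarrow> (\<forall>j<f. level_digit x m j = 0))"
proof
  assume zero: "\<forall>m. 1 \<le> m \<and> m < n \<longrightarrow> (\<forall>j<f. level_digit x m j = 0)"
  then have "digit_approx n (level_digit x) = 1"
    unfolding digit_approx_def by (intro prod.neutral ballI) (auto intro!: prod.neutral)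
  then show "unit_of x \<in> U n"
    using congr_sym[OF unit_of_congr_digit[of n x]] by (simp add: U_def)
next
  assume U: "unit_of x \<in> U n"
  have "\<forall>j<f. level_digit x m j = 0" if "1 \<le> m" "m < n" for m
    using that
  proof (induction m rule: less_induct)
    case (less m)
    have "digit_approx m (level_digit x) = 1"
      unfolding digit_approx_def using less
      by (intro prod.neutral ballI) (auto intro!: prod.neutral)
    then have "digit_approx (Suc m) (level_digit x) = (\<Prod>j<f. w m j ^ level_digit x m j)"
      using less.prems by (simp add: digit_approx_Suc)
    moreover have "digit_approx (Suc m) (level_digit x) \<in> U (Suc m)"
      using congr_in_U[OF unit_of_congr_digit] U U_mono[of "Suc m" n] less.prems by simp
    ultimately have "p dvd level_digit x m j" if "j < f" for j
      using graded_independentD[OF basis] less.prems that by simp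
    then show ?case
      using level_digit_less[OF x less.prems(1)] by (meson dvd_imp_le not_gr_zero not_le)
  qed
  then show "\<forall>m. 1 \<le> m \<and> m < n \<longrightarrow> (\<forall>j<f. level_digit x m j = 0)" by blast
qed

lemma unit_of_filt_iff:
  assumes x: "x \<in> carrier M" and n: "1 \<le> n"
  shows "unit_of x \<in> U n \<longleftrightarrow> x \<in> filt M n"
  unfolding unit_of_in_U_iff[OF x n] M_shift_pow_filt_iff[OF shift_\<rho> p_pos x]
proof (intro iffI allI impI ballI)
  fix j i k
  assume "\<forall>m. 1 \<le> m \<and> m < n \<longrightarrow> (\<forall>j<f. level_digit x m j = 0)"
    and "j < f" "i \<in> T" "(\<rho> ^^ k) i < n"
  then show "Zp_digit p (x j i) k = 0"
    using level_digit_eq[of i x k j] level_ge_1[of i k] by simp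
next
  fix m j
  assume zero: "\<forall>j<f. \<forall>i\<in>T. \<forall>k. (\<rho> ^^ k) i < n \<longrightarrow> Zp_digit p (x j i) k = 0"
    and m: "1 \<le> m \<and> m < n" and j: "j < f"
  obtain i k where "i \<in> T" "m = (\<rho> ^^ k) i"
    using level_cases[of m] m by blast
  then show "level_digit x m j = 0"
    using zero m j by (simp add: level_digit_eq)
qed

text \<open>Digits are found level by level, each time by expanding the remaining quotient in the basis of
  the next graded piece.\<close>

lemma digit_expansion_exists:
  assumes t: "t \<in> U 1"
  shows "\<exists>D. (\<forall>n\<ge>1. \<forall>j<f. D n j < p) \<and> (\<forall>N. congr N (digit_approx N D) t)"
proof -
  define S where "S n s = (SOME c. (\<forall>j<f. c j < p) \<and> congr (Suc n) (\<Prod>j<f. w n j ^ c j) s)" for n s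
  have S: "(\<forall>j<f. S n s j < p) \<and> congr (Suc n) (\<Prod>j<f. w n j ^ S n s j) s" if "1 \<le> n" "s \<in> U n" for n s
    using someI_ex[OF graded_independent_spans[OF that(1) basis[OF that(1)] that(2)]]
    unfolding S_def by blast
  define Y where "Y = rec_nat 1 (\<lambda>n y. y * (if n = 0 then 1 else \<Prod>j<f. w n j ^ S n (t / y) j))"
  define D where "D n = S n (t / Y n)" for n
  have Y: "Y N = digit_approx N D" for N
    by (induction N) (simp_all add: Y_def D_def digit_approx_Suc)
  have Y_U: "Y N \<in> U 1" for N
    using digit_approx_in_U by (simp add: Y)
  have congr: "congr N (Y N) t" for N
  proof (induction N)
    case 0
    show ?case using t U_mono[of 0 1 t] by (simp add: Y U_def congr_sym)
  next
    case (Suc N)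
    show ?case
    proof (cases "N = 0")
      case True
      then show ?thesis using t by (simp add: Y digit_approx_Suc U_def congr_sym)
    next
      case False
      then have "t / Y N \<in> U N"
        using U_divide_iff[of t "Y N" N] t Y_U congr_sym[OF Suc] by simp
      then have "congr (Suc N) (\<Prod>j<f. w N j ^ D N j) (t / Y N)"
        using S[of N "t / Y N"] False by (simp add: D_def)
      moreover have "(\<Prod>j<f. w N j ^ D N j) \<in> U 1"
        using digit_factor_in_U[of N "D N"] U_principal[of N] False by simp
      ultimately have "congr (Suc N) (Y N * (\<Prod>j<f. w N j ^ D N j)) (Y N * (t / Y N))"
        using Y_U by (intro congr_units_mult) auto
      then show ?thesis
        using False principal_unit_nonzero[of "Y N"] Y_U by (simp add: Y digit_approx_Suc)
    qed
  qed
  have "D n j < p" if "1 \<le> n" "j < f" for n j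
  proof -
    have "t / Y n \<in> U n"
      using U_divide_iff[of t "Y n" n] t Y_U congr_sym[OF congr] by simp
    then show ?thesis using S that by (simp add: D_def)
  qed
  then show ?thesis using congr unfolding Y by blast
qed

lemma unit_of_surj:
  assumes "t \<in> U 1"
  shows "\<exists>x\<in>carrier M. unit_of x = t"
proof -
  obtain D where D: "\<And>n j. 1 \<le> n \<Longrightarrow> j < f \<Longrightarrow> D n j < p"
    and approx: "\<And>N. congr N (digit_approx N D) t"
    using digit_expansion_exists[OF assms] by blast
  define x where "x = (\<lambda>j\<in>{..<f}. \<lambda>i\<in>T. Zp_of_digits p (\<lambda>k. D ((\<rho> ^^ k) i) j))"
  have x: "x \<in> carrier M"
    unfolding x_def M_shift_pow_eq using D level_ge_1
    by (auto intro!: Zp_of_digits_closed)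
  have "level_digit x n j = D n j" if n: "1 \<le> n" and j: "j < f" for n j
  proof -
    obtain i k where ik: "i \<in> T" "n = (\<rho> ^^ k) i"
      using level_cases[OF n] by blast
    have "Zp_digit p (x j i) k = D ((\<rho> ^^ k) i) j"
      using ik(1) j D level_ge_1 by (simp add: x_def Zp_digit_of_digits)
    then show ?thesis using ik by (simp add: level_digit_eq)
  qed
  then have "digit_approx N (level_digit x) = digit_approx N D" for N
    unfolding digit_approx_def by (intro prod.cong) auto
  then have "congr N (digit_approx N D) (unit_of x)" for N
    using unit_of_congr_digit[of N x] by simp
  then have "unit_of x = t"
    using P_limit_unique[of "\<lambda>N. digit_approx N D"] approx unfolding congr_def by blast
  then show ?thesis using x by blast
qed

lemma U_filtered_isomorphic_M: "filtered_isomorphic (Zp p) (U_filtered nm) M"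
proof (rule filtered_isomorphicI)
  show U: "filtered_module (Zp p) (U_filtered nm)" by (rule filtered_module_U)
  show "filtered_module (Zp p) M"
    by (rule filtered_module_M_shift_pow[OF shift_\<rho> p_pos])
  then interpret M: filtered_module "Zp p" M .
  \<comment> \<open>Injectivity: an element of the kernel lies in every step of the filtration.\<close>
  have "x = y" if xy: "x \<in> carrier M" "y \<in> carrier M" "unit_of x = unit_of y" for x y
  proof -
    define z where "z = x \<oplus>\<^bsub>M\<^esub> (\<ominus>\<^bsub>M\<^esub> y)"
    have z: "z \<in> carrier M" "z \<oplus>\<^bsub>M\<^esub> y = x"
      using xy by (simp_all add: z_def M.M.a_assoc M.M.l_neg)
    then have "unit_of z * unit_of y = unit_of y"
      using unit_of_add[of z y] xy by simp
    then have "unit_of z = 1"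
      using principal_unit_nonzero[of "unit_of y"] unit_of_in_U_1[of y] by simp
    then have "z = \<zero>\<^bsub>M\<^esub>"
      using unit_of_filt_iff[OF z(1)] by (intro M.filt_separatedD) simp
    then show "x = y"
      using z(2) xy by simp
  qed
  then show "bij_betw unit_of (carrier M) (carrier (U_filtered nm))"
    using unit_of_in_U_1 unit_of_surj by (auto simp: bij_betw_def inj_on_def image_iff) metis
qed (simp_all add: unit_of_add unit_of_smult unit_of_filt_iff)

end

section \<open>Local fields\<close>

context nonarch_field
begin

lemma nm_mult_less_1: "nm x \<le> 1 \<Longrightarrow> nm y < 1 \<Longrightarrow> nm (x * y) < 1"
  using mult_right_mono[of "nm x" 1 "nm y"] by (simp add: nm_mult)

lemma nm_mult_less_1': "nm x < 1 \<Longrightarrow> nm y \<le> 1 \<Longrightarrow> nm (x * y) < 1"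
  using nm_mult_less_1[of y x] by (simp add: mult.commute)

lemma nm_less_1_prime:
  assumes "nm (x * y) < 1" "nm x \<le> 1" "nm y \<le> 1"
  shows "nm x < 1 \<or> nm y < 1"
  using assms by (auto simp: nm_mult order_le_less)

lemma int_ring_simps [simp]:
  "carrier (int_ring nm) = {x. nm x \<le> 1}"
  "mult (int_ring nm) = (*)"
  "one (int_ring nm) = 1"
  "zero (int_ring nm) = 0"
  "add (int_ring nm) = (+)"
  by (simp_all add: int_ring_def)

lemma int_ring_cring: "cring (int_ring nm)"
proof (rule cringI)
  show "abelian_group (int_ring nm)"
  proof (rule abelian_groupI)
    show "\<exists>y\<in>carrier (int_ring nm). y \<oplus>\<^bsub>int_ring nm\<^esub> x = \<zero>\<^bsub>int_ring nm\<^esub>"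
      if "x \<in> carrier (int_ring nm)" for x
      using that by (intro bexI[of _ "- x"]) auto
    show "x \<oplus>\<^bsub>int_ring nm\<^esub> y \<in> carrier (int_ring nm)"
      if "x \<in> carrier (int_ring nm)" "y \<in> carrier (int_ring nm)" for x y
      using that nm_add[of x y] by auto
  qed auto
  show "comm_monoid (int_ring nm)"
    by (rule comm_monoidI) (auto simp: nm_mult intro: mult_le_one)
qed (auto simp: distrib_right)

lemma max_ideal_ideal: "ideal (max_ideal nm) (int_ring nm)"
proof -
  interpret cring "int_ring nm" by (rule int_ring_cring)
  show ?thesis
  proof (rule idealI)
    show "ring (int_ring nm)" by (rule ring_axioms)
    show "subgroup (max_ideal nm) (add_monoid (int_ring nm))"
    proof (rule group.subgroupI)
      show "group (add_monoid (int_ring nm))" by (rule add.is_group)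
      show "inv\<^bsub>add_monoid (int_ring nm)\<^esub> x \<in> max_ideal nm" if "x \<in> max_ideal nm" for x
      proof -
        have "\<ominus>\<^bsub>int_ring nm\<^esub> x = - x"
          by (rule minus_equality) (use that in \<open>auto simp: max_ideal_def\<close>)
        then show ?thesis using that by (simp add: max_ideal_def a_inv_def)
      qed
      show "x \<otimes>\<^bsub>add_monoid (int_ring nm)\<^esub> y \<in> max_ideal nm"
        if "x \<in> max_ideal nm" "y \<in> max_ideal nm" for x y
        using that nm_add[of x y] by (auto simp: max_ideal_def)
    qed (auto simp: max_ideal_def intro!: exI[of _ 0])
  qed (auto simp: max_ideal_def intro: nm_mult_less_1 nm_mult_less_1')
qed

lemma residue_class_eq: "max_ideal nm +>\<^bsub>int_ring nm\<^esub> x = {y. nm (x - y) < 1}"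
proof -
  have "y \<in> max_ideal nm +>\<^bsub>int_ring nm\<^esub> x \<longleftrightarrow> nm (x - y) < 1" for y
  proof -
    have "y \<in> max_ideal nm +>\<^bsub>int_ring nm\<^esub> x \<longleftrightarrow> y - x \<in> max_ideal nm"
      by (auto simp: a_r_coset_def' intro: bexI[of _ "y - x"])
    then show ?thesis by (simp add: max_ideal_def nm_diff_commute)
  qed
  then show ?thesis by auto
qed

lemma residue_field_carrier:
  "carrier (residue_field nm) = (\<lambda>x. {y. nm (x - y) < 1}) ` {x. nm x \<le> 1}"
  by (auto simp: residue_field_def FactRing_def A_RCOSETS_def' residue_class_eq)

lemma residue_field_zero: "\<zero>\<^bsub>residue_field nm\<^esub> = {y. nm (0 - y) < 1}"
  by (simp add: residue_field_def FactRing_def max_ideal_def)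

text \<open>The class of \<open>n\<close> in the residue field is \<open>n\<close> times the class of 1, so the order of the latter decides
  which integers lie in the maximal ideal.\<close>

lemma residue_char_dvd_iff: "residue_char nm dvd n \<longleftrightarrow> nm (of_nat n) < 1"
proof -
  interpret ideal "max_ideal nm" "int_ring nm" by (rule max_ideal_ideal)
  interpret Q: ring "residue_field nm"
    unfolding residue_field_def by (rule quotient_is_ring)
  have hom: "(+>\<^bsub>int_ring nm\<^esub>) (max_ideal nm) \<in> ring_hom (int_ring nm) (residue_field nm)"
    unfolding residue_field_def by (rule rcos_ring_hom)
  have pow: "[k] \<cdot>\<^bsub>residue_field nm\<^esub> \<one>\<^bsub>residue_field nm\<^esub> = max_ideal nm +>\<^bsub>int_ring nm\<^esub> of_nat k" for k
  proof (induction k)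
    case 0
    show ?case by (simp add: residue_class_eq residue_field_zero)
  next
    case (Suc k)
    have "\<one>\<^bsub>residue_field nm\<^esub> = max_ideal nm +>\<^bsub>int_ring nm\<^esub> 1"
      using ring_hom_one[OF hom] by simp
    then show ?case
      using Suc ring_hom_add[OF hom, of "of_nat k" 1] nm_of_nat[of k]
      by (simp add: add.commute)
  qed
  have "residue_char nm dvd n \<longleftrightarrow> [n] \<cdot>\<^bsub>residue_field nm\<^esub> \<one>\<^bsub>residue_field nm\<^esub> = \<zero>\<^bsub>residue_field nm\<^esub>"
    using Q.add.pow_eq_id[of "\<one>\<^bsub>residue_field nm\<^esub>" n] by (simp add: residue_char_def add_pow_def)
  also have "\<dots> \<longleftrightarrow> {y. nm (of_nat n - y) < 1} = {y. nm (0 - y) < 1}"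
    unfolding pow residue_field_zero residue_class_eq by simp
  also have "\<dots> \<longleftrightarrow> nm (of_nat n) < 1"
  proof
    assume "{y. nm (of_nat n - y) < 1} = {y. nm (0 - y) < 1}"
    then have "0 \<in> {y. nm (of_nat n - y) < 1}" by simp
    then show "nm (of_nat n) < 1" by simp
  next
    assume n: "nm (of_nat n) < 1"
    have "nm (of_nat n - y) < 1 \<longleftrightarrow> nm y < 1" for y
      using n nm_diff[of "of_nat n" y] nm_diff[of "of_nat n" "of_nat n - y"] by auto
    then show "{y. nm (of_nat n - y) < 1} = {y. nm (0 - y) < 1}" by simp
  qed
  finally show ?thesis .
qed

text \<open>Every ball can be scaled into a compact neighbourhood of 0.\<close>

lemma integers_seq_compact:
  assumes compact: "locally_compact_space (abs_topology nm)"
    and \<pi>: "0 < nm \<pi>" "nm \<pi> < 1" and s: "\<And>n::nat. nm (s n) \<le> 1"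
  shows "\<exists>l r. strict_mono r \<and> (\<lambda>n. nm (s (r n) - l)) \<longlonglongrightarrow> 0"
proof -
  interpret MS: Metric_space UNIV "\<lambda>x y. nm (x - y)" by (rule Metric_space_nm)
  have top: "abs_topology nm = MS.mtopology" by (simp add: abs_topology_def)
  have "0 \<in> topspace MS.mtopology" by simp
  then obtain V K where VK: "openin MS.mtopology V" "compactin MS.mtopology K" "0 \<in> V" "V \<subseteq> K"
    using compact unfolding locally_compact_space_def top by blast
  obtain \<delta> where \<delta>: "\<delta> > 0" "MS.mball 0 \<delta> \<subseteq> V"
    using VK(1,3) unfolding MS.openin_mtopology by blast
  obtain n where n: "nm \<pi> ^ n < \<delta>"
    using real_arch_pow_inv[OF \<delta>(1) \<pi>(2)] by blast
  have pin: "0 < nm \<pi> ^ n" using \<pi>(1) by simp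
  have in_K: "\<pi> ^ n * s k \<in> K" for k
  proof -
    have "nm (\<pi> ^ n * s k) \<le> nm \<pi> ^ n"
      using mult_left_mono[OF s[of k], of "nm \<pi> ^ n"] pin by (simp add: nm_mult nm_power)
    then have "\<pi> ^ n * s k \<in> MS.mball 0 \<delta>"
      using n by simp
    then show ?thesis using \<delta>(2) VK(4) by blast
  qed
  then obtain l r where r: "strict_mono r"
    and lim: "limitin MS.mtopology ((\<lambda>k. \<pi> ^ n * s k) \<circ> r) l sequentially"
    using VK(2) unfolding MS.compactin_sequentially by (metis image_subset_iff)
  have "(\<lambda>k. nm (\<pi> ^ n * s (r k) - l)) \<longlonglongrightarrow> 0"
    using lim limitin_abs_topology_iff[of "\<lambda>k. \<pi> ^ n * s (r k)" l] by (simp add: top comp_def)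
  then have "(\<lambda>k. nm (\<pi> ^ n * s (r k) - l) / nm \<pi> ^ n) \<longlonglongrightarrow> 0 / nm \<pi> ^ n"
    using pin by (intro tendsto_divide tendsto_const less_imp_neq[symmetric])
  moreover have "nm (\<pi> ^ n * s (r k) - l) / nm \<pi> ^ n = nm (s (r k) - l / \<pi> ^ n)" for k
  proof -
    have "\<pi> \<noteq> 0" using \<pi>(1) by auto
    then have "(\<pi> ^ n * s (r k) - l) / \<pi> ^ n = s (r k) - l / \<pi> ^ n"
      by (simp add: diff_divide_distrib)
    then show ?thesis by (metis nm_divide nm_power)
  qed
  ultimately show ?thesis using r by auto
qed

text \<open>Representatives of infinitely many residue classes would be a sequence without convergent
  subsequence.\<close>

lemma finite_residue_field:
  assumes seq: "\<And>s. (\<And>n::nat. nm (s n) \<le> 1) \<Longrightarrow>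
    \<exists>l r. strict_mono r \<and> (\<lambda>n. nm (s (r n) - l)) \<longlonglongrightarrow> 0"
  shows "finite (carrier (residue_field nm))"
proof (rule ccontr)
  assume "infinite (carrier (residue_field nm))"
  then obtain c :: "nat \<Rightarrow> 'a set" where c: "inj c" "range c \<subseteq> carrier (residue_field nm)"
    using infinite_countable_subset by blast
  then have "\<forall>n. \<exists>x. nm x \<le> 1 \<and> c n = {y. nm (x - y) < 1}"
    unfolding residue_field_carrier by blast
  then obtain s where s: "\<And>n. nm (s n) \<le> 1" "\<And>n. c n = {y. nm (s n - y) < 1}"
    by metis
  obtain l r where r: "strict_mono r" and lim: "(\<lambda>n. nm (s (r n) - l)) \<longlonglongrightarrow> 0"
    using seq[of s] s(1) by blast
  obtain N where N: "\<And>n. N \<le> n \<Longrightarrow> nm (s (r n) - l) < 1"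
    using order_tendstoD(2)[OF lim, of 1] by (auto simp: eventually_sequentially)
  have "nm (s (r n) - y) < 1 \<longleftrightarrow> nm (l - y) < 1" if "N \<le> n" for n y
  proof -
    have "nm (s (r n) - y) \<le> max (nm (s (r n) - l)) (nm (l - y))"
      using nm_add[of "s (r n) - l" "l - y"] by simp
    moreover have "nm (l - y) \<le> max (nm (s (r n) - y)) (nm (s (r n) - l))"
      using nm_diff[of "s (r n) - y" "s (r n) - l"] by simp
    ultimately show ?thesis
      using N[OF that] by linarith
  qed
  then have "c (r N) = c (r (Suc N))"
    using s(2) by simp
  then have "r N = r (Suc N)"
    using c(1) by (simp add: inj_eq)
  then show False
    using strict_monoD[OF r, of N "Suc N"] by simp
qed

end

text \<open>The normalized valuation supplies an element of value 1, whose powers exhaust the values; the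
  remaining properties come from compactness and from the order of 1 in the residue field.\<close>

lemma local_field_uniformized:
  fixes nm :: "'a::field \<Rightarrow> real" and v :: "'a \<Rightarrow> ereal"
  assumes lf: "local_field nm" and p: "p = residue_char nm"
    and card: "order (residue_field nm) = p ^ f"
    and v: "normalized_valuation nm v" and e: "ereal_of_enat e = v (of_nat p)"
  shows "\<exists>\<pi>. uniformized_field nm \<pi> p f e"
proof -
  interpret nonarch_field nm
    using lf by unfold_locales (simp add: local_field_def)
  have v_0: "v 0 = \<infinity>"
    and v_image: "v ` (UNIV - {0}) = range (\<lambda>k::int. ereal (of_int k))"
    and v_mult': "\<forall>x y. v (x * y) = v x + v y"
    and v_le': "\<forall>x y. nm x \<le> nm y \<longleftrightarrow> v y \<le> v x"
    using v unfolding normalized_valuation_def by - (elim conjE; assumption)+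
  have v_mult: "v (x * y) = v x + v y" and v_le: "nm x \<le> nm y \<longleftrightarrow> v y \<le> v x" for x y
    using v_mult' v_le' by simp_all
  have v_int: "\<exists>k::int. v x = ereal (of_int k)" if "x \<noteq> 0" for x
    using v_image that by (metis DiffI UNIV_I imageE imageI singletonD)
  have v_eq: "nm x = nm y \<longleftrightarrow> v x = v y" for x y
    using v_le[of x y] v_le[of y x] by (auto intro: order_antisym)
  have v_1: "v 1 = 0"
    using v_int[of 1] v_mult[of 1 1] by auto
  have "ereal (of_int 1) \<in> v ` (UNIV - {0})"
    unfolding v_image by (rule rangeI)
  then obtain \<pi> where "ereal (of_int 1) = v \<pi>" "\<pi> \<in> UNIV - {0}"
    by (rule imageE)
  then have \<pi>0: "\<pi> \<noteq> 0" and v_\<pi>: "v \<pi> = 1"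
    by (simp_all add: one_ereal_def)
  have \<pi>_pos: "0 < nm \<pi>"
    using \<pi>0 by (metis nm_eq_0 nm_nonneg order_le_less)
  have \<pi>_less: "nm \<pi> < 1"
    using v_le[of 1 \<pi>] v_1 v_\<pi> by simp
  have v_power: "v (\<pi> ^ n) = ereal (real n)" for n
    by (induction n) (simp_all add: v_1 v_mult v_\<pi> one_ereal_def)
  have value_group: "\<exists>k::int. nm x = nm \<pi> powi k" if "x \<noteq> 0" for x
  proof -
    obtain k :: int where k: "v x = ereal (of_int k)"
      using v_int \<open>x \<noteq> 0\<close> by blast
    have "nm x = nm \<pi> powi k"
    proof (cases "0 \<le> k")
      case True
      then have "v x = v (\<pi> ^ nat k)" using k v_power by simp
      then show ?thesis
        using True v_eq by (metis nm_power power_int_def)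
    next
      case False
      then have "v (x * \<pi> ^ nat (- k)) = v 1" using k v_power v_1 v_mult by simp
      then have "nm x * nm \<pi> ^ nat (- k) = 1"
        using v_eq[of "x * \<pi> ^ nat (- k)" 1] by (simp add: nm_mult nm_power)
      then show ?thesis
        using False \<pi>0 by (simp add: power_int_def field_simps)
    qed
    then show ?thesis by blast
  qed
  have seq: "\<exists>l r. strict_mono r \<and> (\<lambda>n. nm (s (r n) - l)) \<longlonglongrightarrow> 0"
    if "\<And>n::nat. nm (s n) \<le> 1" for s
    using integers_seq_compact[OF _ \<pi>_pos \<pi>_less that] lf by (simp add: local_field_def)
  have finite: "finite (carrier (residue_field nm))"
    by (rule finite_residue_field[OF seq])
  have card': "card (carrier (residue_field nm)) = p ^ f"
    using card by (simp add: order_def)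
  have dvd: "p dvd n \<longleftrightarrow> nm (of_nat n) < 1" for n
    unfolding p by (rule residue_char_dvd_iff)
  \<comment> \<open>Otherwise \<open>p ^ f\<close> would be 0 or 1, but the residue field is finite and contains the classes of 0
    and 1.\<close>
  have "p \<noteq> 0"
  proof
    assume "p = 0"
    define C where "C x = {y. nm (x - y) < 1}" for x
    have "1 \<in> C 1" "1 \<notin> C 0"
      by (simp_all add: C_def)
    then have "C 0 \<noteq> C 1" by blast
    then have "card {C 0, C 1} = 2" by simp
    moreover have "{C 0, C 1} \<subseteq> carrier (residue_field nm)"
      unfolding residue_field_carrier C_def by (auto intro: image_eqI[of _ _ 0] image_eqI[of _ _ 1])
    ultimately have "2 \<le> card (carrier (residue_field nm))"
      using card_mono[OF finite] by metis
    then show False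
      using card' \<open>p = 0\<close> by (cases f) auto
  qed
  moreover have "\<not> p dvd 1"
    using dvd[of 1] by simp
  moreover have "p dvd a \<or> p dvd b" if "p dvd a * b" for a b
    using that nm_less_1_prime[of "of_nat a" "of_nat b"] nm_of_nat by (simp add: dvd)
  ultimately have prime: "normalization_semidom_class.prime p"
    unfolding normalization_semidom_class.prime_def by (intro conjI prime_elemI) simp_all
  have nm_p_less: "nm (of_nat p) < 1"
    using dvd[of p] by simp
  have e0: "e \<noteq> 0"
  proof
    assume "e = 0"
    then have "v (of_nat p) = v 1" using e v_1 by simp
    then show False using v_eq[of "of_nat p" 1] nm_p_less by simp
  qed
  have nm_p: "nm (of_nat p) = (case e of enat n \<Rightarrow> nm \<pi> ^ n | \<infinity> \<Rightarrow> 0)"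
  proof (cases e)
    case (enat n)
    then have "v (of_nat p) = v (\<pi> ^ n)" using e v_power by simp
    then show ?thesis using v_eq enat by (simp flip: nm_power)
  next
    case infinity
    then have "v (of_nat p) = v 0" using e v_0 by simp
    then show ?thesis using v_eq[of "of_nat p" 0] infinity by simp
  qed
  have "uniformized_field nm \<pi> p f e"
    by unfold_locales
      (use \<pi>_pos \<pi>_less value_group seq prime card' e0 nm_p in \<open>auto simp: residue_field_carrier\<close>)
  then show ?thesis by blast
qed

theorem theorem1p2:
  fixes nm :: "'a::field \<Rightarrow> real" and v :: "'a \<Rightarrow> ereal"
    and p f :: nat and e :: enat
  assumes "local_field nm"
    and "p = residue_char nm"
    and "order (residue_field nm) = p ^ f"
    and "normalized_valuation nm v"
    and "ereal_of_enat e = v (of_nat p)"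
  shows "filtered_isomorphic (Zp p) (U_filtered nm) (M_shift_pow p (rho e p) f)
           \<longleftrightarrow> (mu p :: 'a set) = {1}"
proof -
  obtain \<pi> where "uniformized_field nm \<pi> p f e"
    using local_field_uniformized[OF assms] by blast
  then interpret uniformized_field nm \<pi> p f e .
  have p0: "p > 0" using p_gt_1 by simp
  interpret Z: cring "Zp p" using p0 by (rule Zp_cring)
  show ?thesis
  proof
    assume iso: "filtered_isomorphic (Zp p) (U_filtered nm) (M_shift_pow p (rho e p) f)"
    have "x = 1" if "x \<in> mu p" for x :: 'a
    proof -
      have x: "x \<in> U 1" "x ^ p = 1"
        using that mu_subset_U by (auto simp: mu_def)
      have "x = \<zero>\<^bsub>U_filtered nm\<^esub>"
      proof (rule filtered_isomorphic_torsion_free[OF iso])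
        show "[p] \<cdot>\<^bsub>Zp p\<^esub> \<one>\<^bsub>Zp p\<^esub> \<in> carrier (Zp p)"
          by (rule Z.add.nat_pow_closed[OF Z.one_closed])
        show "x \<in> carrier (U_filtered nm)" using x(1) by simp
        show "([p] \<cdot>\<^bsub>Zp p\<^esub> \<one>\<^bsub>Zp p\<^esub>) \<odot>\<^bsub>U_filtered nm\<^esub> x = \<zero>\<^bsub>U_filtered nm\<^esub>"
          unfolding U_filtered_simps padic_pow_p[OF x(1)] by (rule x(2))
      qed (rule M_shift_pow_torsion_free[OF p0])
      then show ?thesis by simp
    qed
    then show "(mu p :: 'a set) = {1}"
      by (auto simp: mu_def)
  next
    assume "(mu p :: 'a set) = {1}"
    then obtain w where "\<forall>n\<ge>1. graded_independent n (w n)"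
      "\<forall>i\<in>shift_compl \<rho>. \<forall>k j. w ((\<rho> ^^ k) i) j = w i j ^ (p ^ k)"
      using compatible_bases_exist by blast
    then interpret compatible_bases nm \<pi> p f e w
      by unfold_locales auto
    show "filtered_isomorphic (Zp p) (U_filtered nm) (M_shift_pow p (rho e p) f)"
      by (rule U_filtered_isomorphic_M)
  qed
qed

end
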